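(* Let $N$ and $v$ be integers with $2\le v\le N+1$. Let $f=\lfloor\frac{N+1}{v}\rfloor$, $d=(f+1)v-N$, and \[\Lambda(N,v)=\Big\lfloor\tfrac{1}{d}\sum_{i=f-d+2}^{f}(f+1-i)\tbinom{N}{i}\Big\rfloor+\sum_{i=0}^{f-d+1}\tbinom{N}{i}.\] Then $\mathrm{LAK}_{(1,1)}(N,v)=\Lambda(N,v)$.
   Context: Binomial coefficients $\binom{N}{i}$ with $i<0$ are $0$ and empty sums are $0$. For an $N\times k$ array $A$ with entries in each column from a $v$-element symbol set $\Sigma$, and a column $\gamma$ and symbol $\sigma$, let $\rho_A(\{(\gamma,\sigma)\})=\{r\in\{1,\dots,N\}:A_{r\gamma}=\sigma\}$. $A$ is a $(1,1)$-locating array, written $(1,1)$-$\mathrm{LA}(N;k,v)$, if $\rho_A(\{(\gamma,\sigma)\})=\rho_A(\{(\gamma',\sigma')\})$ implies $(\gamma,\sigma)=(\gamma',\sigma')$. $\mathrm{LAK}_{(1,1)}(N,v)$ is the largest $k$ for which a $(1,1)$-$\mathrm{LA}(N;k,v)$ exists. *)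

theory Defs
  imports Complex_Main
begin

definition rho :: "nat \<Rightarrow> (nat \<Rightarrow> nat \<Rightarrow> 'a) \<Rightarrow> nat \<times> 'a \<Rightarrow> nat set" where
  "rho N A = (\<lambda>(\<gamma>, \<sigma>). {r \<in> {1..N}. A r \<gamma> = \<sigma>})"

text \<open>An \<open>N \<times> k\<close> array is a function \<open>A\<close> whose entry in row \<open>r\<close>, column \<open>\<gamma>\<close> is \<open>A r \<gamma>\<close>;
  its values outside rows \<open>1..N\<close> and columns \<open>1..k\<close> are irrelevant. A symbol of \<open>\<Sigma>\<close> need not
  occur in a given column: the empty row set takes part in the locating condition as well.\<close>

definition locating_array_11 ::
    "nat \<Rightarrow> nat \<Rightarrow> nat \<Rightarrow> 'a set \<Rightarrow> (nat \<Rightarrow> nat \<Rightarrow> 'a) \<Rightarrow> bool" where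
  "locating_array_11 N k v \<Sigma> A \<longleftrightarrow>
     finite \<Sigma> \<and> card \<Sigma> = v \<and>
     (\<forall>r\<in>{1..N}. \<forall>\<gamma>\<in>{1..k}. A r \<gamma> \<in> \<Sigma>) \<and>
     (\<forall>\<gamma>\<in>{1..k}. \<forall>\<sigma>\<in>\<Sigma>. \<forall>\<gamma>'\<in>{1..k}. \<forall>\<sigma>'\<in>\<Sigma>.
        rho N A (\<gamma>, \<sigma>) = rho N A (\<gamma>', \<sigma>') \<longrightarrow> (\<gamma>, \<sigma>) = (\<gamma>', \<sigma>'))"

text \<open>Only the cardinality of the symbol set matters, so symbols are taken to be natural numbers.\<close>

definition LAK_11 :: "nat \<Rightarrow> nat \<Rightarrow> nat" where
  "LAK_11 N v = (GREATEST k. \<exists>(\<Sigma> :: nat set) A. locating_array_11 N k v \<Sigma> A)"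

definition binom :: "nat \<Rightarrow> int \<Rightarrow> int" where
  "binom N i = (if i < 0 then 0 else int (N choose nat i))"

definition Lambda :: "nat \<Rightarrow> nat \<Rightarrow> int" where
  "Lambda N v =
     (let f = \<lfloor>real (N + 1) / real v\<rfloor>;
          d = (f + 1) * int v - int N
      in \<lfloor>1 / real_of_int d * real_of_int (\<Sum>i = f - d + 2..f. (f + 1 - i) * binom N i)\<rfloor>
         + (\<Sum>i = 0..f - d + 1. binom N i))"

end

theory Submission
  imports Defs "HOL-Library.Multiset"
begin

text \<open>A column of the array is an ordered partition of the rows into \<open>v\<close> possibly empty parts, and
  all parts of all columns must be different sets. Give a set of size \<open>i\<close> the deficit \<open>f + 1 - i\<close>:
  the deficits in a column add up to \<open>d\<close>, so after truncation to \<open>{0..d}\<close> they add up to at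
  least \<open>d\<close>, and summing over all subsets gives the upper bound.

  For the lower bound, a Baranyai-type theorem reduces the construction to choosing the part sizes:
  any list of column shapes is realisable as long as no size \<open>i\<close> is used more than \<open>N choose i\<close> times.
  Every set of size \<open>i\<close> and deficit at least \<open>d\<close> gets its own column, completed by one part of size
  \<open>2 * f + 2 - d - i\<close> and \<open>v - 2\<close> parts of size \<open>f + 1\<close>. The sets of deficit \<open>1, \<dots>, d - 1\<close> are packed
  into columns of total deficit exactly \<open>d\<close>, again completed by parts of size \<open>f + 1\<close>. It remains to
  check that the number of parts of size \<open>f + 1\<close> does not exceed \<open>N choose (f + 1)\<close>.\<close>

subsection \<open>Rounding fractional assignments\<close>

text \<open>The residual graph of the assignment \<open>h\<close> on the support of
  \<open>W\<close>: an edge is a possible move of a single element.\<close>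

definition reassignments :: "'a set \<Rightarrow> ('a \<Rightarrow> 'c \<Rightarrow> nat) \<Rightarrow> ('a \<Rightarrow> 'c) \<Rightarrow> ('c \<times> 'c) set" where
  "reassignments \<Gamma> W h = {(c, c'). \<exists>\<gamma>\<in>\<Gamma>. h \<gamma> = c \<and> W \<gamma> c' > 0}"

text \<open>Cut the walk at its last visit to \<open>c\<close>. The rest avoids \<open>c\<close>,
  which lets \<open>reassign_along_path\<close> delete \<open>c\<close> and use induction on the
  vertex set.\<close>

lemma rtrancl_leave_start:
  assumes "(c, c') \<in> R\<^sup>*"
  shows "c' = c \<or> (\<exists>c1. c1 \<noteq> c \<and> (c, c1) \<in> R \<and> (c1, c') \<in> (R \<inter> ((- {c}) \<times> (- {c})))\<^sup>*)"
  using assms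
proof (induction rule: rtrancl_induct)
  case base
  then show ?case by simp
next
  case (step y z)
  show ?case
  proof (cases "z = c \<or> y = c")
    case True
    then show ?thesis using step by blast
  next
    case False
    then obtain c1 where c1: "c1 \<noteq> c" "(c, c1) \<in> R" "(c1, y) \<in> (R \<inter> ((- {c}) \<times> (- {c})))\<^sup>*"
      using step by blast
    have "(y, z) \<in> R \<inter> ((- {c}) \<times> (- {c}))" using False step by blast
    then show ?thesis using c1 by (meson rtrancl.rtrancl_into_rtrancl)
  qed
qed

text \<open>One element is moved along each edge of the path, so inner vertices gain one and lose
  one. Indicator terms on both sides avoid subtraction and cover \<open>c = c'\<close>.\<close>

lemma reassign_along_path:
  assumes "finite D" "finite \<Gamma>"
    and "(c, c') \<in> (reassignments \<Gamma> W h \<inter> D \<times> D)\<^sup>*"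
    and "\<forall>\<gamma>\<in>\<Gamma>. W \<gamma> (h \<gamma>) > 0"
  shows "\<exists>h'. (\<forall>\<gamma>\<in>\<Gamma>. W \<gamma> (h' \<gamma>) > 0) \<and>
    (\<forall>x. card {\<gamma>\<in>\<Gamma>. h' \<gamma> = x} + (if x = c then 1 else 0) =
         card {\<gamma>\<in>\<Gamma>. h \<gamma> = x} + (if x = c' then 1 else 0))"
  using assms
proof (induction D arbitrary: c h rule: finite_psubset_induct)
  case (psubset D)
  show ?case
  proof (cases "c' = c")
    case True
    then show ?thesis using psubset.prems by (intro exI[of _ h]) auto
  next
    case False
    let ?R = "reassignments \<Gamma> W h \<inter> D \<times> D"
    obtain c1 where c1: "c1 \<noteq> c" "(c, c1) \<in> ?R"
      and path: "(c1, c') \<in> (?R \<inter> ((- {c}) \<times> (- {c})))\<^sup>*"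
      using rtrancl_leave_start[OF psubset.prems(2)] False by blast
    obtain \<gamma>1 where g1: "\<gamma>1 \<in> \<Gamma>" "h \<gamma>1 = c" "W \<gamma>1 c1 > 0"
      using c1 unfolding reassignments_def by blast
    define h1 where "h1 = h(\<gamma>1 := c1)"
    \<comment> \<open>An edge leaving a vertex other than \<open>c\<close> is witnessed by an
      element not assigned to \<open>c\<close>, hence not by \<open>\<gamma>1\<close>; moving
      \<open>\<gamma>1\<close> destroys none of these edges.\<close>
    have "?R \<inter> ((- {c}) \<times> (- {c})) \<subseteq> reassignments \<Gamma> W h1 \<inter> (D - {c}) \<times> (D - {c})"
      using g1 unfolding reassignments_def h1_def by fastforce
    then have "(c1, c') \<in> (reassignments \<Gamma> W h1 \<inter> (D - {c}) \<times> (D - {c}))\<^sup>*"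
      using path rtrancl_mono by blast
    moreover have "D - {c} \<subset> D" using c1 by blast
    moreover have "\<forall>\<gamma>\<in>\<Gamma>. W \<gamma> (h1 \<gamma>) > 0" using psubset.prems g1 by (auto simp: h1_def)
    ultimately obtain h' where h': "\<forall>\<gamma>\<in>\<Gamma>. W \<gamma> (h' \<gamma>) > 0"
      "\<And>x. card {\<gamma>\<in>\<Gamma>. h' \<gamma> = x} + (if x = c1 then 1 else 0) =
         card {\<gamma>\<in>\<Gamma>. h1 \<gamma> = x} + (if x = c' then 1 else 0)"
      using psubset.IH[of "D - {c}" c1 h1] psubset.prems(1) by blast
    have "card {\<gamma>\<in>\<Gamma>. h1 \<gamma> = x} + (if x = c then 1 else 0) =
         card {\<gamma>\<in>\<Gamma>. h \<gamma> = x} + (if x = c1 then 1 else 0)" for x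
    proof -
      consider "x = c" | "x = c1" | "x \<noteq> c" "x \<noteq> c1" by blast
      then show ?thesis
      proof cases
        case 1
        have "{\<gamma>\<in>\<Gamma>. h \<gamma> = x} = insert \<gamma>1 {\<gamma>\<in>\<Gamma>. h1 \<gamma> = x}"
          using 1 g1 c1 by (auto simp: h1_def)
        moreover have "\<gamma>1 \<notin> {\<gamma>\<in>\<Gamma>. h1 \<gamma> = x}" using 1 c1 by (simp add: h1_def)
        ultimately show ?thesis using 1 c1 \<open>finite \<Gamma>\<close> by simp
      next
        case 2
        have "{\<gamma>\<in>\<Gamma>. h1 \<gamma> = x} = insert \<gamma>1 {\<gamma>\<in>\<Gamma>. h \<gamma> = x}"
          using 2 g1 c1 by (auto simp: h1_def)
        moreover have "\<gamma>1 \<notin> {\<gamma>\<in>\<Gamma>. h \<gamma> = x}" using 2 c1 g1 by simp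
        ultimately show ?thesis using 2 c1 \<open>finite \<Gamma>\<close> by simp
      next
        case 3
        then have "{\<gamma>\<in>\<Gamma>. h1 \<gamma> = x} = {\<gamma>\<in>\<Gamma>. h \<gamma> = x}"
          using g1 by (auto simp: h1_def)
        then show ?thesis using 3 by simp
      qed
    qed
    note h1_card = this
    have "card {\<gamma>\<in>\<Gamma>. h' \<gamma> = x} + (if x = c then 1 else 0) =
         card {\<gamma>\<in>\<Gamma>. h \<gamma> = x} + (if x = c' then 1 else 0)" for x
      using h'(2)[of x] h1_card[of x] by linarith
    then show ?thesis using h'(1) by blast
  qed
qed

lemma card_preimage_eq_sum:
  assumes "finite \<Gamma>" "finite R"
  shows "card {\<gamma>\<in>\<Gamma>. h \<gamma> \<in> R} = (\<Sum>c\<in>R. card {\<gamma>\<in>\<Gamma>. h \<gamma> = c})"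
proof -
  have "{\<gamma>\<in>\<Gamma>. h \<gamma> \<in> R} = (\<Union>c\<in>R. {\<gamma>\<in>\<Gamma>. h \<gamma> = c})" by auto
  then show ?thesis using assms by (simp only:) (subst card_UN_disjoint; auto)
qed

text \<open>The matrix \<open>W / n\<close> is a fractional assignment of the elements of \<open>\<Gamma>\<close> whose column sums lie
  between \<open>L\<close> and \<open>U\<close>; an integral one is found by augmenting along reassignment paths.\<close>

lemma integral_assignment:
  fixes W :: "'a \<Rightarrow> 'c \<Rightarrow> nat" and L U :: "'c \<Rightarrow> nat"
  assumes fin: "finite \<Gamma>" "finite C" and n: "n > 0"
    and supp: "\<And>\<gamma> c. \<gamma> \<in> \<Gamma> \<Longrightarrow> c \<notin> C \<Longrightarrow> W \<gamma> c = 0"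
    and row: "\<And>\<gamma>. \<gamma> \<in> \<Gamma> \<Longrightarrow> (\<Sum>c\<in>C. W \<gamma> c) = n"
    and low: "\<And>c. c \<in> C \<Longrightarrow> n * L c \<le> (\<Sum>\<gamma>\<in>\<Gamma>. W \<gamma> c)"
    and up: "\<And>c. c \<in> C \<Longrightarrow> (\<Sum>\<gamma>\<in>\<Gamma>. W \<gamma> c) \<le> n * U c"
  shows "\<exists>h. (\<forall>\<gamma>\<in>\<Gamma>. W \<gamma> (h \<gamma>) > 0) \<and>
    (\<forall>c\<in>C. L c \<le> card {\<gamma>\<in>\<Gamma>. h \<gamma> = c} \<and> card {\<gamma>\<in>\<Gamma>. h \<gamma> = c} \<le> U c)"
proof -
  define valid where "valid h \<longleftrightarrow> (\<forall>\<gamma>\<in>\<Gamma>. W \<gamma> (h \<gamma>) > 0)" for h :: "'a \<Rightarrow> 'c"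
  define cnt where "cnt h c = card {\<gamma>\<in>\<Gamma>. h \<gamma> = c}" for h :: "'a \<Rightarrow> 'c" and c
  \<comment> \<open>Truncated subtraction makes each summand the amount by which a count violates
    its bounds, above or below.\<close>
  define V where "V h = (\<Sum>c\<in>C. (cnt h c - U c) + (L c - cnt h c))" for h
  have LU: "L c \<le> U c" if "c \<in> C" for c
    using low[OF that] up[OF that] n by (meson le_trans mult_le_cancel1)
  have "\<exists>c. W \<gamma> c > 0" if "\<gamma> \<in> \<Gamma>" for \<gamma>
    using row[OF that] n by (metis gr0I sum.neutral)
  then have "\<exists>h. valid h" unfolding valid_def by metis
  then obtain h where h: "valid h" and min: "\<And>h'. valid h' \<Longrightarrow> V h \<le> V h'"
    using ex_has_least_nat[of valid _ V] by blast
  \<comment> \<open>Otherwise shifting one unit from \<open>c\<close> to \<open>c'\<close> would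
    worsen no violation and reduce one, against the minimality of \<open>V\<close>.\<close>
  have no_path: False
    if path: "(c, c') \<in> (reassignments \<Gamma> W h \<inter> C \<times> C)\<^sup>*" and "c \<in> C" "c' \<in> C" "c \<noteq> c'"
      "cnt h c > L c" "cnt h c' < U c'" "cnt h c > U c \<or> cnt h c' < L c'" for c c'
  proof -
    obtain h' where h': "valid h'"
      "\<And>x. cnt h' x + (if x = c then 1 else 0) = cnt h x + (if x = c' then 1 else 0)"
      using reassign_along_path[OF fin(2) fin(1) path] h unfolding valid_def cnt_def by blast
    have at_c: "cnt h' c = cnt h c - 1" and at_c': "cnt h' c' = cnt h c' + 1"
      using h'(2)[of c] h'(2)[of c'] that(4) by auto
    have other: "cnt h' x = cnt h x" if "x \<noteq> c" "x \<noteq> c'" for x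
      using h'(2)[of x] that by simp
    have le: "(cnt h' x - U x) + (L x - cnt h' x) \<le> (cnt h x - U x) + (L x - cnt h x)"
      if "x \<in> C" for x
      using at_c at_c' other[of x] \<open>cnt h c > L c\<close> \<open>cnt h c' < U c'\<close>
      by (cases "x = c"; cases "x = c'") auto
    moreover have "(cnt h' c - U c) + (L c - cnt h' c) < (cnt h c - U c) + (L c - cnt h c) \<or>
       (cnt h' c' - U c') + (L c' - cnt h' c') < (cnt h c' - U c') + (L c' - cnt h c')"
      using at_c at_c' that LU[of c] LU[of c'] by auto
    ultimately have "V h' < V h" unfolding V_def
      using that(2,3) fin(2) by (intro sum_strict_mono_ex1) blast+
    then show False using min[OF h'(1)] by simp
  qed
  have up_ok: "cnt h c \<le> U c" if c: "c \<in> C" for c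
  proof (rule ccontr)
    assume over: "\<not> cnt h c \<le> U c"
    \<comment> \<open>No bin reachable from the overfull \<open>c\<close> has free capacity, and the
      elements in these bins carry all their weight there; double counting that weight contradicts
      \<open>up\<close>.\<close>
    define R where "R = {c'. (c, c') \<in> (reassignments \<Gamma> W h \<inter> C \<times> C)\<^sup>*}"
    have RC: "R \<subseteq> C" unfolding R_def using c by (auto elim: rtranclE)
    have finR: "finite R" using RC fin finite_subset by blast
    have cR: "c \<in> R" by (simp add: R_def)
    have full: "U c' \<le> cnt h c'" if "c' \<in> R" for c'
      using no_path[of c c'] that RC over c LU[OF c] by (cases "c' = c") (auto simp: R_def subset_iff not_less[symmetric])
    define G where "G = {\<gamma>\<in>\<Gamma>. h \<gamma> \<in> R}"
    have closed: "W \<gamma> c' = 0" if "\<gamma> \<in> G" "c' \<in> C - R" for \<gamma> c'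
    proof (rule ccontr)
      assume "W \<gamma> c' \<noteq> 0"
      then have "(h \<gamma>, c') \<in> reassignments \<Gamma> W h \<inter> C \<times> C"
        using that RC unfolding G_def reassignments_def by auto
      then have "c' \<in> R" using that(1) unfolding G_def R_def
        by (auto intro: rtrancl.rtrancl_into_rtrancl)
      then show False using that by simp
    qed
    have "n * card G = (\<Sum>\<gamma>\<in>G. \<Sum>c\<in>C. W \<gamma> c)" using row by (simp add: G_def)
    also have "\<dots> = (\<Sum>\<gamma>\<in>G. \<Sum>c\<in>R. W \<gamma> c)"
      using closed RC fin by (intro sum.cong refl sum.mono_neutral_right) auto
    also have "\<dots> \<le> (\<Sum>\<gamma>\<in>\<Gamma>. \<Sum>c\<in>R. W \<gamma> c)"
      using fin by (intro sum_mono2) (auto simp: G_def)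
    also have "\<dots> = (\<Sum>c\<in>R. \<Sum>\<gamma>\<in>\<Gamma>. W \<gamma> c)" by (rule sum.swap)
    also have "\<dots> \<le> (\<Sum>c\<in>R. n * U c)" using up RC by (intro sum_mono) auto
    also have "\<dots> = n * (\<Sum>c\<in>R. U c)" by (simp add: sum_distrib_left)
    also have "\<dots> < n * (\<Sum>c\<in>R. cnt h c)"
      using n full over cR finR by (auto intro!: sum_strict_mono_ex1 bexI[of _ c])
    also have "\<dots> = n * card G"
      using card_preimage_eq_sum[OF fin(1) finR] by (simp add: G_def cnt_def)
    finally show False by simp
  qed
  have low_ok: "L c \<le> cnt h c" if c: "c \<in> C" for c
  proof (rule ccontr)
    assume under: "\<not> L c \<le> cnt h c"
    \<comment> \<open>Dual argument: the bins from which \<open>c\<close> can be reached have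
      nothing to spare, and elements outside them carry no weight on them, which contradicts
      \<open>low\<close>.\<close>
    define R where "R = {c'. (c', c) \<in> (reassignments \<Gamma> W h \<inter> C \<times> C)\<^sup>*}"
    have RC: "R \<subseteq> C" unfolding R_def using c by (auto elim: converse_rtranclE)
    have finR: "finite R" using RC fin finite_subset by blast
    have cR: "c \<in> R" by (simp add: R_def)
    have empty: "cnt h c' \<le> L c'" if "c' \<in> R" for c'
      using no_path[of c' c] that RC under c LU[OF c] by (cases "c' = c") (auto simp: R_def subset_iff not_less[symmetric])
    define G where "G = {\<gamma>\<in>\<Gamma>. h \<gamma> \<in> R}"
    have closed: "W \<gamma> c' = 0" if "\<gamma> \<in> \<Gamma> - G" "c' \<in> R" for \<gamma> c'
    proof (rule ccontr)
      assume "W \<gamma> c' \<noteq> 0"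
      moreover have "h \<gamma> \<in> C" using h supp that unfolding valid_def by fastforce
      ultimately have "(h \<gamma>, c') \<in> reassignments \<Gamma> W h \<inter> C \<times> C"
        using that RC unfolding G_def reassignments_def by auto
      then have "h \<gamma> \<in> R" using that(2) unfolding R_def
        by (auto intro: converse_rtrancl_into_rtrancl)
      then show False using that by (simp add: G_def)
    qed
    have "n * (\<Sum>c\<in>R. cnt h c) < n * (\<Sum>c\<in>R. L c)"
      using n empty under cR finR by (auto intro!: sum_strict_mono_ex1 bexI[of _ c])
    also have "\<dots> = (\<Sum>c\<in>R. n * L c)" by (simp add: sum_distrib_left)
    also have "\<dots> \<le> (\<Sum>c\<in>R. \<Sum>\<gamma>\<in>\<Gamma>. W \<gamma> c)" using low RC by (intro sum_mono) auto
    also have "\<dots> = (\<Sum>\<gamma>\<in>\<Gamma>. \<Sum>c\<in>R. W \<gamma> c)" by (rule sum.swap)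
    also have "\<dots> = (\<Sum>\<gamma>\<in>G. \<Sum>c\<in>R. W \<gamma> c)"
      using closed fin by (intro sum.mono_neutral_right) (auto simp: G_def)
    also have "\<dots> \<le> (\<Sum>\<gamma>\<in>G. \<Sum>c\<in>C. W \<gamma> c)"
      using RC fin by (intro sum_mono sum_mono2) auto
    also have "\<dots> = n * card G" using row by (simp add: G_def)
    also have "\<dots> = n * (\<Sum>c\<in>R. cnt h c)"
      using card_preimage_eq_sum[OF fin(1) finR] by (simp add: G_def cnt_def)
    finally show False by simp
  qed
  show ?thesis using h up_ok low_ok unfolding valid_def cnt_def by blast
qed

subsection \<open>Arrays with prescribed part sizes\<close>

lemma sum_card_parts:
  fixes A :: "nat \<Rightarrow> nat \<Rightarrow> nat"
  assumes "\<forall>r\<in>{1..l}. A r \<gamma> < v"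
  shows "(\<Sum>\<sigma><v. card (rho l A (\<gamma>, \<sigma>))) = l"
proof -
  have "{r\<in>{1..l}. A r \<gamma> \<in> {..<v}} = {1..l}" using assms by auto
  then show ?thesis
    using card_preimage_eq_sum[of "{1..l}" "{..<v}" "\<lambda>r. A r \<gamma>"] by (simp add: rho_def)
qed

text \<open>Read \<open>m\<close> as the number of parts in one class, each lacking \<open>a\<close>
  of the \<open>n\<close> remaining rows. If each gets the next row with fraction
  \<open>a / n\<close>, absorption shows that the expected numbers of extended and of unextended
  parts respect the two summands of Pascal's rule.\<close>

lemma binomial_split_bounds:
  fixes m n a :: nat
  assumes "m \<le> n choose a" "n > 0"
  shows "m * a \<le> n * (if a = 0 then 0 else (n - 1) choose (a - 1))"
    and "n * (m - ((n - 1) choose a)) \<le> m * a"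
proof -
  have abs: "a * (n choose a) = n * (if a = 0 then 0 else (n - 1) choose (a - 1))"
    using times_binomial_minus1_eq[of a n] by auto
  then show "m * a \<le> n * (if a = 0 then 0 else (n - 1) choose (a - 1))"
    using assms(1) by (metis mult.commute mult_le_mono1)
  show "n * (m - ((n - 1) choose a)) \<le> m * a"
  proof (cases "a \<le> n")
    case True
    have "(n - a) * m \<le> (n - a) * (n choose a)" using assms by simp
    also have "\<dots> = n * ((n - 1) choose a)" by (simp add: binomial_absorb_comp)
    finally have "n * m \<le> n * ((n - 1) choose a) + m * a"
      using True by (simp add: algebra_simps diff_mult_distrib2)
    then show ?thesis by (simp add: diff_mult_distrib2)
  next
    case False
    then have "m = 0" using assms by (simp add: binomial_eq_0)
    then show ?thesis by simp
  qed
qed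

text \<open>Baranyai's argument: the rows are added one at a time, and after \<open>l\<close> rows a part of intended
  size \<open>i\<close> currently equal to \<open>S\<close> occurs at most as often as \<open>S\<close> can be extended to an \<open>i\<close>-subset of
  \<open>{1..N}\<close> by elements larger than \<open>l\<close>.\<close>

lemma partial_array_with_prescribed_sizes:
  fixes t :: "nat \<Rightarrow> nat \<Rightarrow> nat"
  assumes fin: "finite \<Gamma>"
    and row: "\<And>\<gamma>. \<gamma> \<in> \<Gamma> \<Longrightarrow> (\<Sum>\<sigma><v. t \<gamma> \<sigma>) = N"
    and few: "\<And>i. card {(\<gamma>, \<sigma>) \<in> \<Gamma> \<times> {..<v}. t \<gamma> \<sigma> = i} \<le> N choose i"
    and "l \<le> N"
  shows "\<exists>A. (\<forall>r\<in>{1..l}. \<forall>\<gamma>\<in>\<Gamma>. A r \<gamma> < v) \<and>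
    (\<forall>S i. card {(\<gamma>, \<sigma>) \<in> \<Gamma> \<times> {..<v}. rho l A (\<gamma>, \<sigma>) = S \<and> t \<gamma> \<sigma> = i} \<le>
           (if card S \<le> i then (N - l) choose (i - card S) else 0))"
  using \<open>l \<le> N\<close>
proof (induction l)
  case 0
  let ?A = "\<lambda>(_::nat) (_::nat). 0 :: nat"
  have rho0: "rho 0 ?A p = {}" for p by (auto simp: rho_def)
  have "card {(\<gamma>, \<sigma>) \<in> \<Gamma> \<times> {..<v}. rho 0 ?A (\<gamma>, \<sigma>) = S \<and> t \<gamma> \<sigma> = i} \<le>
      (if card S \<le> i then (N - 0) choose (i - card S) else 0)" for S i
    using few[of i] by (cases "S = {}") (auto simp: rho0)
  moreover have "\<forall>r\<in>{1..0}. \<forall>\<gamma>\<in>\<Gamma>. ?A r \<gamma> < v" by simp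
  ultimately show ?case by (intro exI[of _ ?A] conjI allI)
next
  case (Suc l)
  define n where "n = N - l"
  have n: "n > 0" "N - Suc l = n - 1" using Suc.prems by (auto simp: n_def)
  obtain A where A0: "(\<forall>r\<in>{1..l}. \<forall>\<gamma>\<in>\<Gamma>. A r \<gamma> < v) \<and>
    (\<forall>S i. card {(\<gamma>, \<sigma>) \<in> \<Gamma> \<times> {..<v}. rho l A (\<gamma>, \<sigma>) = S \<and> t \<gamma> \<sigma> = i} \<le>
           (if card S \<le> i then (N - l) choose (i - card S) else 0))"
    using Suc.IH[OF Suc_leD[OF Suc.prems]] by (elim exE)
  have A: "A r \<gamma> < v" if "r \<in> {1..l}" "\<gamma> \<in> \<Gamma>" for r \<gamma>
    using A0 that by blast
  have cntA: "card {(\<gamma>, \<sigma>) \<in> \<Gamma> \<times> {..<v}. rho l A (\<gamma>, \<sigma>) = S \<and> t \<gamma> \<sigma> = i} \<le>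
           (if card S \<le> i then n choose (i - card S) else 0)" for S i
    using conjunct2[OF A0, rule_format, of S i] unfolding n_def .
  \<comment> \<open>Parts that agree in current row set and intended size, in whatever column, form
    one class.\<close>
  define cl where "cl \<gamma> \<sigma> = (rho l A (\<gamma>, \<sigma>), t \<gamma> \<sigma>)" for \<gamma> \<sigma>
  define E where "E c = {(\<gamma>, \<sigma>) \<in> \<Gamma> \<times> {..<v}. cl \<gamma> \<sigma> = c}" for c
  have finE: "finite (E c)" for c
    by (rule finite_subset[of _ "\<Gamma> \<times> {..<v}"]) (use fin in \<open>auto simp: E_def\<close>)
  have cardE: "card (E (S, i)) \<le> (if card S \<le> i then n choose (i - card S) else 0)" for S i
    using cntA[of S i] by (simp add: E_def cl_def)
  define C where "C = (\<lambda>(\<gamma>, \<sigma>). cl \<gamma> \<sigma>) ` (\<Gamma> \<times> {..<v})"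
  have size_le: "card S \<le> i" if Si: "(S, i) \<in> C" for S i
  proof -
    obtain \<gamma> \<sigma> where "\<gamma> \<in> \<Gamma>" "\<sigma> < v" "cl \<gamma> \<sigma> = (S, i)" using Si by (auto simp: C_def)
    then have "(\<gamma>, \<sigma>) \<in> E (S, i)" by (simp add: E_def)
    then have "E (S, i) \<noteq> {}" by blast
    then have "card (E (S, i)) > 0" using finE by (simp add: card_gt_0_iff)
    then show ?thesis using cardE[of S i] by (auto split: if_splits)
  qed
  \<comment> \<open>The number of elements still missing in the parts of one class. All parts of a
    column together lack \<open>n\<close> elements, so \<open>W / n\<close> distributes the next row
    of each column among the classes.\<close>
  define W where "W \<gamma> c = (\<Sum>\<sigma>\<in>{\<sigma>. \<sigma> < v \<and> cl \<gamma> \<sigma> = c}. snd c - card (fst c))" for \<gamma> c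
  define U where "U c = (if snd c = card (fst c) then 0 else (n - 1) choose (snd c - card (fst c) - 1))"
    for c :: "nat set \<times> nat"
  define L where "L c = card (E c) - ((n - 1) choose (snd c - card (fst c)))" for c
  have W_sum: "(\<Sum>\<gamma>\<in>\<Gamma>. W \<gamma> c) = card (E c) * (snd c - card (fst c))" for c
  proof -
    have "E c = Sigma \<Gamma> (\<lambda>\<gamma>. {\<sigma>. \<sigma> < v \<and> cl \<gamma> \<sigma> = c})" by (auto simp: E_def)
    then have "card (E c) = (\<Sum>\<gamma>\<in>\<Gamma>. card {\<sigma>. \<sigma> < v \<and> cl \<gamma> \<sigma> = c})"
      using fin by (simp add: card_SigmaI)
    then show ?thesis by (simp add: W_def sum_distrib_right)
  qed
  have row_W: "(\<Sum>c\<in>C. W \<gamma> c) = n" if g: "\<gamma> \<in> \<Gamma>" for \<gamma>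
  proof -
    have le: "card (rho l A (\<gamma>, \<sigma>)) \<le> t \<gamma> \<sigma>" if "\<sigma> < v" for \<sigma>
      using size_le[of "rho l A (\<gamma>, \<sigma>)" "t \<gamma> \<sigma>"] g that by (force simp: C_def cl_def)
    have "(\<Sum>c\<in>C. W \<gamma> c) = (\<Sum>c\<in>C. \<Sum>\<sigma>\<in>{\<sigma>\<in>{..<v}. cl \<gamma> \<sigma> = c}. t \<gamma> \<sigma> - card (rho l A (\<gamma>, \<sigma>)))"
      unfolding W_def by (intro sum.cong) (auto simp: cl_def)
    also have "\<dots> = (\<Sum>\<sigma><v. t \<gamma> \<sigma> - card (rho l A (\<gamma>, \<sigma>)))"
      using fin g by (intro sum.group) (auto simp: C_def)
    also have "\<dots> = (\<Sum>\<sigma><v. t \<gamma> \<sigma>) - (\<Sum>\<sigma><v. card (rho l A (\<gamma>, \<sigma>)))"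
      using le by (intro sum_subtractf_nat) auto
    also have "\<dots> = n" using row[OF g] sum_card_parts[of l A \<gamma> v] A g by (simp add: n_def)
    finally show ?thesis .
  qed
  have "\<exists>h. (\<forall>\<gamma>\<in>\<Gamma>. W \<gamma> (h \<gamma>) > 0) \<and>
    (\<forall>c\<in>C. L c \<le> card {\<gamma>\<in>\<Gamma>. h \<gamma> = c} \<and> card {\<gamma>\<in>\<Gamma>. h \<gamma> = c} \<le> U c)"
  proof (rule integral_assignment[where n = n])
    show "finite \<Gamma>" "finite C" using fin by (auto simp: C_def)
    show "0 < n" by (rule n(1))
    show "W \<gamma> c = 0" if "\<gamma> \<in> \<Gamma>" "c \<notin> C" for \<gamma> c
    proof -
      have "{\<sigma>. \<sigma> < v \<and> cl \<gamma> \<sigma> = c} = {}" using that by (auto simp: C_def)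
      then show ?thesis by (simp add: W_def)
    qed
    show "(\<Sum>c\<in>C. W \<gamma> c) = n" if "\<gamma> \<in> \<Gamma>" for \<gamma> by (rule row_W[OF that])
    fix c assume c: "c \<in> C"
    have "card (E c) \<le> n choose (snd c - card (fst c))" "card (fst c) \<le> snd c"
      using cardE[of "fst c" "snd c"] size_le[of "fst c" "snd c"] c by auto
    then show "n * L c \<le> (\<Sum>\<gamma>\<in>\<Gamma>. W \<gamma> c)" "(\<Sum>\<gamma>\<in>\<Gamma>. W \<gamma> c) \<le> n * U c"
      using binomial_split_bounds[of "card (E c)" n "snd c - card (fst c)"] n(1)
      unfolding W_sum L_def U_def by (auto split: if_splits)
  qed
  then obtain h where h: "\<And>\<gamma>. \<gamma> \<in> \<Gamma> \<Longrightarrow> W \<gamma> (h \<gamma>) > 0"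
    and hL: "\<And>c. c \<in> C \<Longrightarrow> L c \<le> card {\<gamma>\<in>\<Gamma>. h \<gamma> = c}"
    and hU: "\<And>c. c \<in> C \<Longrightarrow> card {\<gamma>\<in>\<Gamma>. h \<gamma> = c} \<le> U c" by blast
  \<comment> \<open>Positive weight forces the chosen class to contain a part of the column; which
    of them receives the row is immaterial.\<close>
  have "\<exists>\<sigma>. \<sigma> < v \<and> cl \<gamma> \<sigma> = h \<gamma>" if "\<gamma> \<in> \<Gamma>" for \<gamma>
  proof (rule ccontr)
    assume "\<nexists>\<sigma>. \<sigma> < v \<and> cl \<gamma> \<sigma> = h \<gamma>"
    then have "{\<sigma>. \<sigma> < v \<and> cl \<gamma> \<sigma> = h \<gamma>} = {}" by blast
    then have "W \<gamma> (h \<gamma>) = 0" unfolding W_def by (simp only: sum.empty)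
    then show False using h[OF that] by simp
  qed
  then obtain s where s: "\<And>\<gamma>. \<gamma> \<in> \<Gamma> \<Longrightarrow> s \<gamma> < v" "\<And>\<gamma>. \<gamma> \<in> \<Gamma> \<Longrightarrow> cl \<gamma> (s \<gamma>) = h \<gamma>"
    by metis
  define A' where "A' = A(Suc l := s)"
  have rho': "rho (Suc l) A' (\<gamma>, \<sigma>) =
      (if s \<gamma> = \<sigma> then insert (Suc l) (rho l A (\<gamma>, \<sigma>)) else rho l A (\<gamma>, \<sigma>))" for \<gamma> \<sigma>
    by (auto simp: rho_def A'_def)
  have rho_le: "rho l A p \<subseteq> {1..l}" for p by (auto simp: rho_def)
  have sel: "card {(\<gamma>, \<sigma>) \<in> E c. s \<gamma> = \<sigma>} = card {\<gamma>\<in>\<Gamma>. h \<gamma> = c}" for c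
  proof -
    have "{(\<gamma>, \<sigma>) \<in> E c. s \<gamma> = \<sigma>} = (\<lambda>\<gamma>. (\<gamma>, s \<gamma>)) ` {\<gamma>\<in>\<Gamma>. h \<gamma> = c}"
      using s by (auto simp: E_def)
    then show ?thesis by (simp add: card_image inj_on_def)
  qed
  have "card {(\<gamma>, \<sigma>) \<in> \<Gamma> \<times> {..<v}. rho (Suc l) A' (\<gamma>, \<sigma>) = S \<and> t \<gamma> \<sigma> = i} \<le>
      (if card S \<le> i then (n - 1) choose (i - card S) else 0)" (is "card ?X \<le> _") for S i
  proof (cases "?X = {}")
    case True
    then show ?thesis by (simp only: card.empty)
  next
    case False
    then obtain \<gamma>0 \<sigma>0 where g0: "\<gamma>0 \<in> \<Gamma>" "\<sigma>0 < v" "rho (Suc l) A' (\<gamma>0, \<sigma>0) = S" "t \<gamma>0 \<sigma>0 = i"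
      by auto
    \<comment> \<open>Parts equal to \<open>S\<close> after the new row come from parts equal to
      \<open>S0\<close>: they received the row if \<open>S\<close> contains it (bound
      \<open>U\<close>) and missed it otherwise (bound \<open>L\<close>).\<close>
    define S0 where "S0 = S - {Suc l}"
    have "Suc l \<notin> rho l A p" for p using rho_le[of p] by auto
    then have S0: "S0 = rho l A (\<gamma>0, \<sigma>0)" using g0(3) by (auto simp: S0_def rho' split: if_splits)
    have finS0: "finite S0" unfolding S0 using rho_le finite_subset by blast
    have c: "(S0, i) \<in> C" using g0 S0 by (auto simp: C_def cl_def image_iff intro!: bexI[of _ "(\<gamma>0, \<sigma>0)"])
    note le = size_le[OF c]
    show ?thesis
    proof (cases "Suc l \<in> S")
      case True
      have X: "?X = {(\<gamma>, \<sigma>) \<in> E (S0, i). s \<gamma> = \<sigma>}"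
        using True \<open>\<And>p. Suc l \<notin> rho l A p\<close> by (auto simp: S0_def rho' E_def cl_def split: if_splits)
      have cardS: "card S = Suc (card S0)"
        using True finS0 by (metis S0_def card_Suc_Diff1 finite_Diff_insert finite.emptyI finite_Diff2 finite_insert)
      have "card {\<gamma>\<in>\<Gamma>. h \<gamma> = (S0, i)} \<le> U (S0, i)" by (rule hU[OF c])
      then have "card ?X \<le> U (S0, i)" unfolding X sel .
      then show ?thesis using le cardS by (auto simp: U_def split: if_splits)
    next
      case False
      then have SS: "S0 = S" by (simp add: S0_def)
      have X: "?X = E (S0, i) - {(\<gamma>, \<sigma>) \<in> E (S0, i). s \<gamma> = \<sigma>}"
        using False by (auto simp: SS rho' E_def cl_def split: if_splits)
      have "card ?X = card (E (S0, i)) - card {\<gamma>\<in>\<Gamma>. h \<gamma> = (S0, i)}"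
        unfolding X sel[symmetric] using finE by (intro card_Diff_subset) (auto intro: finite_subset[of _ "E (S0, i)"])
      also have "\<dots> \<le> (n - 1) choose (i - card S0)"
        using hL[OF c] by (simp add: L_def)
      finally show ?thesis using le SS by simp
    qed
  qed
  moreover have "\<forall>r\<in>{1..Suc l}. \<forall>\<gamma>\<in>\<Gamma>. A' r \<gamma> < v"
    using A s by (auto simp: A'_def le_Suc_eq)
  ultimately show ?case unfolding n(2) by blast
qed

text \<open>With no rows left the bound becomes \<open>0 choose (i - card S)\<close>, so every part
  has its intended size and no set occurs twice.\<close>

lemma array_with_prescribed_sizes:
  fixes t :: "nat \<Rightarrow> nat \<Rightarrow> nat"
  assumes fin: "finite \<Gamma>"
    and row: "\<And>\<gamma>. \<gamma> \<in> \<Gamma> \<Longrightarrow> (\<Sum>\<sigma><v. t \<gamma> \<sigma>) = N"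
    and few: "\<And>i. card {(\<gamma>, \<sigma>) \<in> \<Gamma> \<times> {..<v}. t \<gamma> \<sigma> = i} \<le> N choose i"
  shows "\<exists>A. (\<forall>r\<in>{1..N}. \<forall>\<gamma>\<in>\<Gamma>. A r \<gamma> < v) \<and>
    inj_on (rho N A) (\<Gamma> \<times> {..<v})"
proof -
  have "\<exists>A. (\<forall>r\<in>{1..N}. \<forall>\<gamma>\<in>\<Gamma>. A r \<gamma> < v) \<and>
    (\<forall>S i. card {(\<gamma>, \<sigma>) \<in> \<Gamma> \<times> {..<v}. rho N A (\<gamma>, \<sigma>) = S \<and> t \<gamma> \<sigma> = i} \<le>
           (if card S \<le> i then (N - N) choose (i - card S) else 0))"
    by (rule partial_array_with_prescribed_sizes) (use assms in auto)
  then obtain A where A: "\<forall>r\<in>{1..N}. \<forall>\<gamma>\<in>\<Gamma>. A r \<gamma> < v"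
    and cnt: "\<And>S i. card {(\<gamma>, \<sigma>) \<in> \<Gamma> \<times> {..<v}. rho N A (\<gamma>, \<sigma>) = S \<and> t \<gamma> \<sigma> = i} \<le>
           (if card S \<le> i then 0 choose (i - card S) else 0)"
    unfolding diff_self_eq_0 by blast
  have finX: "finite {(\<gamma>, \<sigma>) \<in> \<Gamma> \<times> {..<v}. rho N A (\<gamma>, \<sigma>) = S \<and> t \<gamma> \<sigma> = i}" for S i
    by (rule finite_subset[of _ "\<Gamma> \<times> {..<v}"]) (use fin in auto)
  have size: "t \<gamma> \<sigma> = card (rho N A (\<gamma>, \<sigma>))" if "\<gamma> \<in> \<Gamma>" "\<sigma> < v" for \<gamma> \<sigma>
  proof (rule ccontr)
    assume ne: "t \<gamma> \<sigma> \<noteq> card (rho N A (\<gamma>, \<sigma>))"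
    let ?X = "{(\<gamma>', \<sigma>') \<in> \<Gamma> \<times> {..<v}. rho N A (\<gamma>', \<sigma>') = rho N A (\<gamma>, \<sigma>) \<and> t \<gamma>' \<sigma>' = t \<gamma> \<sigma>}"
    have "card ?X = 0" using cnt[of "rho N A (\<gamma>, \<sigma>)" "t \<gamma> \<sigma>"] ne
      by (auto split: if_splits simp: binomial_eq_0)
    moreover have "(\<gamma>, \<sigma>) \<in> ?X" using that by simp
    ultimately show False using finX[of "rho N A (\<gamma>, \<sigma>)" "t \<gamma> \<sigma>"] by auto
  qed
  have "p = p'" if p: "p \<in> \<Gamma> \<times> {..<v}" "p' \<in> \<Gamma> \<times> {..<v}" "rho N A p = rho N A p'" for p p'
  proof -
    define S where "S = rho N A p"
    let ?X = "{(\<gamma>, \<sigma>) \<in> \<Gamma> \<times> {..<v}. rho N A (\<gamma>, \<sigma>) = S \<and> t \<gamma> \<sigma> = card S}"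
    have "p \<in> ?X" "p' \<in> ?X" using p size by (auto simp: S_def)
    moreover have "card ?X \<le> 1" using cnt[of S "card S"] by simp
    ultimately show ?thesis using finX[of S "card S"] by (metis (no_types, lifting) card_le_Suc0_iff_eq One_nat_def)
  qed
  then have "inj_on (rho N A) (\<Gamma> \<times> {..<v})" by (auto intro!: inj_onI)
  then show ?thesis using A by blast
qed

subsection \<open>Packing deficits into columns\<close>

text \<open>Worst-fit decreasing: each item goes to a least filled bin, so it fits as soon as the average
  load of the larger items leaves room for it, and large items occupy all bins before sharing one.\<close>

lemma worst_fit_packing:
  fixes s :: "'a \<Rightarrow> nat" and K d :: nat
  assumes "finite I"
    and "\<And>x. x \<in> I \<Longrightarrow> 1 \<le> s x \<and> s x \<le> d"
    and "\<And>x. x \<in> I \<Longrightarrow> (\<Sum>y\<in>{y\<in>I. s x \<le> s y}. s y) < K * (d - s x + 1) + s x"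
  shows "\<exists>b. b ` I \<subseteq> {..<K} \<and> (\<forall>k<K. (\<Sum>x\<in>{x\<in>I. b x = k}. s x) \<le> d) \<and>
    (inj_on b {x\<in>I. 2 \<le> s x} \<or> b ` {x\<in>I. 2 \<le> s x} = {..<K})"
  using assms
\<comment> \<open>Ranking by the negated size adds the items in decreasing order, so
  \<open>x\<close> is smallest. The rule does not exclude \<open>x \<in> S\<close>, hence the
  separate case.\<close>
proof (induction I rule: finite_ranking_induct[where f = "\<lambda>x. - int (s x)"])
  case empty
  then show ?case by simp
next
  case (insert x S)
  show ?case
  proof (cases "x \<in> S")
    case True
    then have eq: "insert x S = S" by blast
    show ?thesis using insert.IH insert.prems unfolding eq by blast
  next
    case False
    have ge: "s x \<le> s y" if "y \<in> S" for y using insert.hyps(2)[OF that] by simp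
    have "(\<Sum>z\<in>{z\<in>S. s y \<le> s z}. s z) < K * (d - s y + 1) + s y" if "y \<in> S" for y
    proof -
      have "(\<Sum>z\<in>{z\<in>S. s y \<le> s z}. s z) \<le> (\<Sum>z\<in>{z\<in>insert x S. s y \<le> s z}. s z)"
        using insert.hyps(1) by (intro sum_mono2) auto
      then show ?thesis using insert.prems(2)[of y] that by simp
    qed
    then obtain b where b: "b ` S \<subseteq> {..<K}" "\<And>k. k < K \<Longrightarrow> (\<Sum>z\<in>{z\<in>S. b z = k}. s z) \<le> d"
      "inj_on b {z\<in>S. 2 \<le> s z} \<or> b ` {z\<in>S. 2 \<le> s z} = {..<K}"
      using insert.IH insert.prems(1) by blast
    define load where "load k = (\<Sum>z\<in>{z\<in>S. b z = k}. s z)" for k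
    have "{z\<in>insert x S. s x \<le> s z} = insert x S" using ge by auto
    then have "sum s (insert x S) < K * (d - s x + 1) + s x"
      using insert.prems(2)[of x] by simp
    then have total: "sum s S < K * (d - s x + 1)"
      using False insert.hyps(1) by simp
    then have "K > 0" by (cases K) auto
    define k0 where "k0 = arg_min_on load {..<K}"
    have k0: "k0 < K" "\<And>k. k < K \<Longrightarrow> load k0 \<le> load k"
      using arg_min_if_finite(1)[of "{..<K}" load] arg_min_least[of "{..<K}" _ load] \<open>K > 0\<close>
      by (auto simp: k0_def)
    \<comment> \<open>The least load is at most the average load, which is below
      \<open>d - s x + 1\<close>.\<close>
    have "K * load k0 \<le> (\<Sum>k<K. load k)"
      using k0(2) sum_bounded_below[of "{..<K}" "load k0" load] by simp
    also have "\<dots> = sum s S" unfolding load_def using b(1) insert.hyps(1)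
      by (intro sum.group) auto
    finally have "K * load k0 < K * (d - s x + 1)" using total by linarith
    then have "load k0 < d - s x + 1" by (simp only: mult_less_cancel1)
    then have fits: "load k0 + s x \<le> d"
      using insert.prems(1)[of x] by (simp add: less_Suc_eq_le le_diff_conv2)
    define b' where "b' = b(x := k0)"
    have img: "b' ` insert x S \<subseteq> {..<K}" using b(1) k0(1) False by (auto simp: b'_def)
    have loads: "(\<Sum>z\<in>{z\<in>insert x S. b' z = k}. s z) \<le> d" if "k < K" for k
    proof (cases "k = k0")
      case True
      have "{z\<in>insert x S. b' z = k} = insert x {z\<in>S. b z = k0}"
        using True False by (auto simp: b'_def)
      then show ?thesis using fits False insert.hyps(1) by (simp add: load_def)
    next
      case neq: False
      have "{z\<in>insert x S. b' z = k} = {z\<in>S. b z = k}"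
        using neq False by (auto simp: b'_def)
      then show ?thesis using b(2)[OF that] by simp
    qed
    have "inj_on b' {z\<in>insert x S. 2 \<le> s z} \<or> b' ` {z\<in>insert x S. 2 \<le> s z} = {..<K}"
    proof (cases "2 \<le> s x")
      case small: False
      then have "{z\<in>insert x S. 2 \<le> s z} = {z\<in>S. 2 \<le> s z}" by auto
      moreover have "inj_on b' {z\<in>S. 2 \<le> s z} = inj_on b {z\<in>S. 2 \<le> s z}"
        using False by (intro inj_on_cong) (auto simp: b'_def)
      moreover have "b' ` {z\<in>S. 2 \<le> s z} = b ` {z\<in>S. 2 \<le> s z}"
        using False by (intro image_cong) (auto simp: b'_def)
      ultimately show ?thesis using b(3) by simp
    next
      case True
      then have all: "{z\<in>insert x S. 2 \<le> s z} = insert x S" "{z\<in>S. 2 \<le> s z} = S"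
        using ge by fastforce+
      have same: "b' ` S = b ` S" using False by (intro image_cong) (auto simp: b'_def)
      show ?thesis
      proof (cases "b ` S = {..<K}")
        case True
        then show ?thesis using all same img by auto
      next
        case nonfull: False
        then have inj: "inj_on b S" using b(3) all by simp
        \<comment> \<open>Some bin is still empty, so the least filled one is empty too and
          injectivity persists.\<close>
        obtain k where k: "k < K" "k \<notin> b ` S" using nonfull b(1) by auto
        have "{z\<in>S. b z = k} = {}" using k(2) by auto
        then have "load k = 0" unfolding load_def by (simp only: sum.empty)
        then have "load k0 = 0" using k0(2)[OF k(1)] by simp
        have "k0 \<notin> b ` S"
        proof
          assume "k0 \<in> b ` S"
          then obtain z where z: "z \<in> S" "b z = k0" by auto
          then have "s z \<le> load k0" unfolding load_def
            using insert.hyps(1) by (intro member_le_sum) auto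
          then show False using insert.prems(1)[of z] z \<open>load k0 = 0\<close> by simp
        qed
        moreover have "inj_on b' S = inj_on b S"
          using False by (intro inj_on_cong) (auto simp: b'_def)
        ultimately have "inj_on b' (insert x S)" using inj same False by (simp add: b'_def)
        then show ?thesis using all by simp
      qed
    qed
    then show ?thesis using img loads by blast
  qed
qed

text \<open>If \<open>d = w + 1\<close>, a bin filled with unit items only would hold too many of them.\<close>

lemma exact_packing:
  fixes s :: "'a \<Rightarrow> nat" and K d :: nat
  assumes fin: "finite I"
    and sz: "\<And>x. x \<in> I \<Longrightarrow> 1 \<le> s x \<and> s x \<le> d"
    and fits: "\<And>x. x \<in> I \<Longrightarrow> (\<Sum>y\<in>{y\<in>I. s x \<le> s y}. s y) < K * (d - s x + 1) + s x"
    and total: "sum s I = K * d"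
    and few: "d \<le> w \<or> (d = w + 1 \<and> K \<le> card {x\<in>I. 2 \<le> s x})"
  shows "\<exists>b. b ` I \<subseteq> {..<K} \<and>
    (\<forall>k<K. (\<Sum>x\<in>{x\<in>I. b x = k}. s x) = d \<and> card {x\<in>I. b x = k} \<le> w)"
proof -
  obtain b where b: "b ` I \<subseteq> {..<K}" "\<And>k. k < K \<Longrightarrow> (\<Sum>x\<in>{x\<in>I. b x = k}. s x) \<le> d"
    "inj_on b {x\<in>I. 2 \<le> s x} \<or> b ` {x\<in>I. 2 \<le> s x} = {..<K}"
    using worst_fit_packing[OF fin sz fits] by blast
  have "(\<Sum>k<K. \<Sum>x\<in>{x\<in>I. b x = k}. s x) = sum s I"
    using b(1) fin by (intro sum.group) auto
  then have sums: "(\<Sum>k<K. \<Sum>x\<in>{x\<in>I. b x = k}. s x) = (\<Sum>k<K. d)" using total by simp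
  have exact: "(\<Sum>x\<in>{x\<in>I. b x = k}. s x) = d" if k: "k < K" for k
    using sum_mono_inv[OF sums _ _ finite_lessThan] b(2) k by simp
  have "card {x\<in>I. b x = k} \<le> w" if k: "k < K" for k
  proof -
    let ?B = "{x\<in>I. b x = k}"
    have finB: "finite ?B" using fin by simp
    have "card ?B = (\<Sum>x\<in>?B. 1)" by simp
    also have "\<dots> \<le> (\<Sum>x\<in>?B. s x)" using sz by (intro sum_mono) auto
    finally have le: "card ?B \<le> d" using exact[OF k] by simp
    show ?thesis
    proof (cases "d \<le> w")
      case True
      then show ?thesis using le by simp
    next
      case False
      then have d: "d = w + 1" "K \<le> card {x\<in>I. 2 \<le> s x}" using few by auto
      \<comment> \<open>There are at least \<open>K\<close> large items, so in distinct bins they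
        fill all bins. Either way every bin holds one, which makes its item count smaller than its
        sum \<open>d\<close>.\<close>
      have "b ` {x\<in>I. 2 \<le> s x} = {..<K}"
      proof (cases "inj_on b {x\<in>I. 2 \<le> s x}")
        case True
        then have "card (b ` {x\<in>I. 2 \<le> s x}) \<ge> card {..<K}" using d by (simp add: card_image)
        then show ?thesis using b(1) by (intro card_seteq) auto
      qed (use b(3) in blast)
      then have "k \<in> b ` {x\<in>I. 2 \<le> s x}" using k by simp
      then obtain x where x: "x \<in> ?B" "2 \<le> s x" by blast
      have "card ?B = (\<Sum>x\<in>?B. 1)" by simp
      also have "\<dots> < (\<Sum>x\<in>?B. s x)"
        using sz x finB by (intro sum_strict_mono_ex1) (auto intro!: bexI[of _ x])
      finally show ?thesis using exact[OF k] d by simp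
    qed
  qed
  then show ?thesis using b(1) exact by blast
qed

subsection \<open>Binomial coefficients by deficit\<close>

text \<open>With \<open>f = (N + 1) div v\<close> one has \<open>d = v + 1 - (N + 1) mod v\<close>,
  which explains the range of \<open>d\<close>.\<close>

locale la_parameters =
  fixes N v f d :: nat
  assumes v_ge: "2 \<le> v" and f_ge: "1 \<le> f" and d_ge: "2 \<le> d" and d_le: "d \<le> v + 1"
    and N_eq: "N + d = (f + 1) * v"
begin

text \<open>A set of size \<open>f + 1 - j\<close> has deficit \<open>j\<close>, and the deficits in a column add up to \<open>d\<close>.\<close>

definition c :: "nat \<Rightarrow> nat" where
  "c j = (if j \<le> f + 1 then N choose (f + 1 - j) else 0)"

text \<open>The sum under the floor in \<open>Lambda\<close>, indexed by deficit instead of size;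
  \<open>K\<close> is then the floored term.\<close>

definition total_deficit :: nat where
  "total_deficit = (\<Sum>j=1..<d. j * c j)"

definition K :: nat where
  "K = total_deficit div d"

lemma fv_le: "f * v \<le> N + 1"
  using N_eq d_le by simp

lemma f_le_N: "f \<le> N"
proof -
  have "f * 2 \<le> f * v" using v_ge by simp
  then show ?thesis using fv_le f_ge by linarith
qed

text \<open>The ratio of neighbouring binomial coefficients, multiplied out; for
  \<open>j > f\<close> both sides are 0.\<close>

lemma c_rec: "c (Suc j) * (N - f + j) = c j * (f + 1 - j)"
proof (cases "j \<le> f")
  case True
  define i where "i = f - j"
  have "f + 1 - j = Suc i" "N - f + j = N - i" "c (Suc j) = N choose i" "c j = N choose Suc i"
    using True f_le_N by (auto simp: i_def c_def Suc_diff_le)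
  moreover have "(N choose i) * (N - i) = (N choose Suc i) * Suc i"
    using binomial_absorb_comp[of N i] binomial_absorption[of i N] by (simp add: mult.commute)
  ultimately show ?thesis by simp
qed (auto simp: c_def)

text \<open>By \<open>c_rec\<close> the quotient of \<open>c j\<close> by \<open>c (Suc j)\<close>
  is \<open>(N - f + j) / (f + 1 - j)\<close>, with numerator at least \<open>(v - 1) * f\<close>
  and denominator at most \<open>f\<close>.\<close>

lemma c_ratio:
  assumes "1 \<le> j"
  shows "(v - 1) * c (Suc j) \<le> c j"
proof -
  have "(v - 1) * f \<le> N - f + j" using fv_le assms f_le_N by (simp add: algebra_simps diff_mult_distrib)
  then have "f * ((v - 1) * c (Suc j)) \<le> c (Suc j) * (N - f + j)"
    by (metis mult.commute mult.left_commute mult_le_mono2)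
  also have "\<dots> = c j * (f + 1 - j)" by (rule c_rec)
  also have "\<dots> \<le> c j * f" using assms by (intro mult_le_mono2) simp
  also have "\<dots> = f * c j" by (rule mult.commute)
  finally show ?thesis using f_ge by simp
qed

lemma c_Suc_le: "1 \<le> j \<Longrightarrow> c (Suc j) \<le> c j"
  using c_ratio[of j] v_ge mult_le_mono1[of 1 "v - 1" "c (Suc j)"] by linarith

lemma c_antimono:
  assumes "1 \<le> i" "i \<le> j"
  shows "c j \<le> c i"
  using assms(2)
proof (induction j rule: dec_induct)
  case (step n)
  then show ?case using c_Suc_le[of n] assms(1) by simp
qed simp

text \<open>Here \<open>N + 1 = f * v\<close>, so the estimate in \<open>c_ratio\<close> is tight at
  \<open>j = 1\<close>.\<close>

lemma c1_eq:
  assumes "d = v + 1"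
  shows "c 1 = (v - 1) * c 2"
proof -
  have "N + 1 = f * v" using N_eq assms by simp
  then have "N - f + 1 = f * (v - 1)" using f_le_N by (simp add: algebra_simps diff_mult_distrib2)
  then have "f * ((v - 1) * c 2) = f * c 1"
    using c_rec[of 1] by (simp add: numeral_2_eq_2 algebra_simps)
  then show ?thesis using f_ge by simp
qed

lemma c2_pos: "1 \<le> c 2"
  using f_ge f_le_N by (simp add: c_def Suc_le_eq)

text \<open>\<open>c_ratio\<close> gives \<open>(v - 2) * c m \<le> c (m - 1) - c m\<close>, which
  telescopes.\<close>

lemma c_tail_sum:
  assumes "3 \<le> m"
  shows "(v - 2) * (\<Sum>j=3..<m. c j) + c (m - 1) \<le> c 2"
  using assms
proof (induction m rule: dec_induct)
  case (step m)
  have "(v - 2) * c m + c m = (v - 1) * c m"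
    using v_ge by (metis Suc_diff_Suc Suc_le_lessD add.commute mult_Suc numeral_2_eq_2 One_nat_def)
  also have "\<dots> \<le> c (m - 1)" using c_ratio[of "m - 1"] step by simp
  finally show ?case using step by (simp add: algebra_simps)
qed simp

text \<open>The weights are at most \<open>v\<close>, and \<open>v \<le> 2 * (v - 2)\<close> for
  \<open>v \<ge> 4\<close>, so \<open>c_tail_sum\<close> applies; \<open>v = 3\<close> leaves at
  most the single term \<open>3 * c 3\<close>.\<close>

lemma weighted_tail_sum: "(\<Sum>j=3..<d. j * c j) \<le> 2 * c 2"
proof (cases "4 \<le> d")
  case False
  then show ?thesis by simp
next
  case d4: True
  show ?thesis
  proof (cases "v = 3")
    case True
    then have "d = 4" using d4 d_le by simp
    then show ?thesis using True c_ratio[of 2] by (simp add: numeral_eq_Suc)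
  next
    case False
    then have v4: "v \<le> 2 * (v - 2)" using d4 d_le by simp
    have "(\<Sum>j=3..<d. j * c j) \<le> (\<Sum>j=3..<d. v * c j)"
      using d_le by (intro sum_mono mult_right_mono) auto
    also have "\<dots> = v * (\<Sum>j=3..<d. c j)" by (simp add: sum_distrib_left)
    also have "\<dots> \<le> 2 * (v - 2) * (\<Sum>j=3..<d. c j)" using v4 by (rule mult_le_mono1)
    also have "\<dots> \<le> 2 * c 2" using c_tail_sum[of d] d4 by simp
    finally show ?thesis .
  qed
qed

lemma total_deficit_split:
  "total_deficit = c 1 + (\<Sum>j=2..<d. j * c j)"
  unfolding total_deficit_def using d_ge by (simp add: sum.atLeast_Suc_lessThan numeral_2_eq_2)

lemma deficit_ge2_split:
  assumes "3 \<le> d"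
  shows "(\<Sum>j=2..<d. j * c j) = 2 * c 2 + (\<Sum>j=3..<d. j * c j)"
  using assms by (simp add: sum.atLeast_Suc_lessThan numeral_3_eq_3 numeral_2_eq_2)

lemma K_mult_le: "K * d \<le> total_deficit"
  by (simp add: K_def)

lemma total_deficit_less: "total_deficit < (K + 1) * d"
  using d_ge dividend_less_div_times[of d total_deficit] by (simp add: K_def add.commute)

lemma c2_le_K:
  assumes "3 \<le> d"
  shows "c 2 \<le> K"
proof -
  have "d * c 2 \<le> (v - 1 + 2) * c 2" using d_le by (intro mult_le_mono1) simp
  also have "\<dots> \<le> c 1 + 2 * c 2"
    using c_ratio[of 1] by (simp add: numeral_2_eq_2 algebra_simps)
  also have "\<dots> \<le> total_deficit" by (simp add: total_deficit_split deficit_ge2_split[OF assms])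
  finally show ?thesis using d_ge by (simp add: K_def less_eq_div_iff_mult_less_eq mult.commute)
qed

text \<open>Makes the truncated subtraction in \<open>c1_used\<close> exact: leaving out sets of
  deficit 1 is enough to reach a multiple of \<open>d\<close>.\<close>

lemma deficit_ge2_le: "(\<Sum>j=2..<d. j * c j) \<le> K * d"
proof -
  consider "d = 2" | "d = 3" | "4 \<le> d" using d_ge by linarith
  then show ?thesis
  proof cases
    case 2
    then show ?thesis using c2_le_K by (simp add: numeral_eq_Suc)
  next
    case 3
    have "(\<Sum>j=2..<d. j * c j) \<le> 4 * c 2"
      using deficit_ge2_split weighted_tail_sum 3 by simp
    also have "\<dots> \<le> K * 4" using c2_le_K 3 by simp
    also have "\<dots> \<le> K * d" using 3 by simp
    finally show ?thesis .
  qed simp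
qed

text \<open>The remainder of \<open>total_deficit\<close> modulo \<open>d\<close> is discarded by leaving out sets of deficit 1.\<close>

definition c1_used :: nat where
  "c1_used = K * d - (\<Sum>j=2..<d. j * c j)"

definition c_used :: "nat \<Rightarrow> nat" where
  "c_used j = (if j = 1 then c1_used else c j)"

lemma c1_used_le: "c1_used \<le> c 1"
  using K_mult_le total_deficit_split by (simp add: c1_used_def)

lemma c_used_le: "c_used j \<le> c j"
  using c1_used_le by (simp add: c_used_def)

lemma c_used_total: "(\<Sum>j=1..<d. j * c_used j) = K * d"
proof -
  have "(\<Sum>j=1..<d. j * c_used j) = c1_used + (\<Sum>j=2..<d. j * c_used j)"
    using d_ge by (simp add: sum.atLeast_Suc_lessThan numeral_2_eq_2 c_used_def)
  also have "(\<Sum>j=2..<d. j * c_used j) = (\<Sum>j=2..<d. j * c j)"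
    by (intro sum.cong) (auto simp: c_used_def)
  finally show ?thesis using deficit_ge2_le by (simp add: c1_used_def)
qed

text \<open>The room condition of \<open>worst_fit_packing\<close>. Tails from
  \<open>j \<ge> 3\<close> are at most \<open>2 * c 2 \<le> 2 * K\<close>; for \<open>j = 2\<close>
  the bound \<open>4 * K\<close> suffices once \<open>d \<ge> 5\<close>.\<close>

lemma c_used_fits:
  assumes "1 \<le> j" "j < d"
  shows "(\<Sum>i=j..<d. i * c_used i) < K * (d - j + 1) + j"
proof (cases "j = 1")
  case True
  then show ?thesis using c_used_total d_ge by simp
next
  case False
  then have j: "2 \<le> j" "3 \<le> d" using assms by auto
  have eq: "(\<Sum>i=j..<d. i * c_used i) = (\<Sum>i=j..<d. i * c i)"
    using j by (intro sum.cong) (auto simp: c_used_def)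
  note K = c2_le_K[OF j(2)]
  show ?thesis
  proof (cases "j = 2")
    case False
    then have "(\<Sum>i=j..<d. i * c i) \<le> (\<Sum>i=3..<d. i * c i)"
      using j by (intro sum_mono2) auto
    also have "\<dots> \<le> K * 2" using weighted_tail_sum K by simp
    also have "\<dots> \<le> K * (d - j + 1)" using assms by (intro mult_le_mono2) simp
    finally show ?thesis using eq j by simp
  next
    case j2: True
    note split = deficit_ge2_split[OF j(2)]
    consider "d = 3" | "d = 4" | "5 \<le> d" using j by linarith
    then show ?thesis
    proof cases
      case 1
      then show ?thesis using eq j2 split K by simp
    next
      case 2
      \<comment> \<open>The bound \<open>4 * K\<close> is too weak here, so the tail is compared
        with \<open>total_deficit\<close> itself; \<open>c2_pos\<close> absorbs the
        rounding.\<close>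
      have "3 \<le> v" using 2 d_le by simp
      then have "2 * c 2 \<le> (v - 1) * c 2" "2 * c 3 \<le> (v - 1) * c 3" by (intro mult_le_mono1; simp)+
      then have "2 * c 2 \<le> c 1" "2 * c 3 \<le> c 2"
        using c_ratio[of 1] c_ratio[of 2] by (auto simp: numeral_eq_Suc)
      moreover have "(\<Sum>i=3..<d. i * c i) = 3 * c 3" using 2 by (simp add: numeral_eq_Suc)
      moreover have "c 1 + 2 * c 2 + 3 * c 3 < 4 * K + 4"
        using total_deficit_less total_deficit_split split calculation 2 by simp
      ultimately have "2 * c 2 + 3 * c 3 < 3 * K + 2" using c2_pos by linarith
      then show ?thesis using eq j2 split 2 \<open>(\<Sum>i=3..<d. i * c i) = 3 * c 3\<close> by simp
    next
      case 3
      have "(\<Sum>i=2..<d. i * c i) \<le> K * 4" using split weighted_tail_sum K by simp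
      also have "\<dots> \<le> K * (d - j + 1)" using 3 j2 by (intro mult_le_mono2) simp
      finally show ?thesis using eq j2 by simp
    qed
  qed
qed

text \<open>\<open>c 1 + 2 * c 2 = d * c 2\<close> by \<open>c1_eq\<close>, and all later weights
  are at most \<open>d\<close>. This supplies the large items that \<open>exact_packing\<close>
  demands when \<open>d = v + 1\<close>.\<close>

lemma K_le_deficit_ge2_count:
  assumes "d = v + 1"
  shows "K \<le> (\<Sum>j=2..<d. c j)"
proof -
  have d3: "3 \<le> d" using assms v_ge by simp
  have "c 1 + 2 * c 2 = d * c 2"
    using c1_eq[OF assms] assms v_ge by (simp add: algebra_simps diff_mult_distrib)
  moreover have "(\<Sum>j=3..<d. j * c j) \<le> d * (\<Sum>j=3..<d. c j)"
    unfolding sum_distrib_left by (intro sum_mono mult_le_mono1) simp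
  moreover have "(\<Sum>j=2..<d. c j) = c 2 + (\<Sum>j=3..<d. c j)"
    using d3 by (simp add: sum.atLeast_Suc_lessThan numeral_3_eq_3 numeral_2_eq_2)
  ultimately have "total_deficit \<le> d * (\<Sum>j=2..<d. c j)"
    using total_deficit_split deficit_ge2_split[OF d3] by (simp add: algebra_simps)
  moreover have "d * K \<le> total_deficit" using K_mult_le by (simp add: mult.commute)
  ultimately have "d * K \<le> d * (\<Sum>j=2..<d. c j)" by linarith
  then show ?thesis using d_ge by (simp only: mult_le_cancel1)
qed

end

section \<open>Bounding the number of parts of size \<open>f + 1\<close>\<close>

text \<open>For negative \<open>\<beta>\<close> the weights and \<open>x\<close> both decrease, and
  Chebyshev's sum inequality reduces the claim to the sum of the weights, which is
  \<open>n / 2\<close> times the first plus the last weight.\<close>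

lemma linear_weighted_sum_nonneg:
  fixes x :: "nat \<Rightarrow> real" and \<alpha> \<beta> :: real
  assumes anti: "\<And>i j. 1 \<le> i \<Longrightarrow> i \<le> j \<Longrightarrow> j \<le> n \<Longrightarrow> x j \<le> x i"
    and pos: "\<And>j. 0 \<le> x j" and n: "1 \<le> n"
    and first: "0 \<le> \<alpha> + \<beta>" and ends: "0 \<le> (\<alpha> + \<beta>) + (\<alpha> + \<beta> * n)"
  shows "0 \<le> (\<Sum>j=1..n. (\<alpha> + \<beta> * j) * x j)"
proof (cases "0 \<le> \<beta>")
  case True
  have "0 \<le> \<alpha> + \<beta> * j" if "1 \<le> j" for j :: nat
    using first True that mult_left_mono[of 1 "real j" \<beta>] by simp
  then show ?thesis using pos by (intro sum_nonneg) auto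
next
  case False
  have shift: "(\<Sum>j=1..n. h j) = (\<Sum>k=0..<n. h (Suc k))" for h :: "nat \<Rightarrow> real"
    by (simp add: sum.shift_bounds_Suc_ivl[symmetric] atLeastLessThanSuc_atLeastAtMost)
  have "2 * (\<Sum>k=0..<n. \<alpha> + \<beta> * real (Suc k)) = n * ((\<alpha> + \<beta>) + (\<alpha> + \<beta> * n))"
    by (induction n) (auto simp: algebra_simps)
  then have tot: "0 \<le> (\<Sum>k=0..<n. \<alpha> + \<beta> * real (Suc k))" using ends
    by (smt (verit) mult_nonneg_nonneg of_nat_0_le_iff)
  have "of_nat n * (\<Sum>k=0..<n. - (\<alpha> + \<beta> * real (Suc k)) * x (Suc k))
      \<le> (\<Sum>k=0..<n. - (\<alpha> + \<beta> * real (Suc k))) * (\<Sum>k=0..<n. x (Suc k))"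
  proof (rule Chebyshev_sum_upper)
    show "- (\<alpha> + \<beta> * real (Suc i)) \<le> - (\<alpha> + \<beta> * real (Suc j))" if "i \<le> j" for i j
      using False that by (simp add: mult_left_mono_neg)
    show "x (Suc j) \<le> x (Suc i)" if "i \<le> j" "j < n" for i j
      using anti[of "Suc i" "Suc j"] that by simp
  qed
  also have "\<dots> = - ((\<Sum>k=0..<n. \<alpha> + \<beta> * real (Suc k)) * (\<Sum>k=0..<n. x (Suc k)))"
    by (simp only: sum_negf mult_minus_left)
  also have "\<dots> \<le> 0" using tot pos by (simp add: sum_nonneg)
  finally have "0 \<le> real n * (\<Sum>k=0..<n. (\<alpha> + \<beta> * real (Suc k)) * x (Suc k))"
    by (simp only: mult_minus_left sum_negf mult_minus_right neg_le_0_iff_le)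
  then have "0 \<le> (\<Sum>k=0..<n. (\<alpha> + \<beta> * real (Suc k)) * x (Suc k))"
    using n by (simp add: zero_le_mult_iff)
  then show ?thesis unfolding shift .
qed

context la_parameters
begin

lemma c_rec_real:
  "real (c (Suc j)) * ((real v - 1) * (real f + 1) + 1 - real d + real j) = real (c j) * (real f + 1 - real j)"
proof (cases "j \<le> f + 1")
  case True
  have "real N + real d = (real f + 1) * real v" using N_eq by (metis of_nat_1 of_nat_add of_nat_mult)
  then have "real (N - f + j) = (real v - 1) * (real f + 1) + 1 - real d + real j"
    using f_le_N by (simp add: algebra_simps of_nat_diff)
  moreover have "real (f + 1 - j) = real f + 1 - real j" using True by (simp add: of_nat_diff)
  ultimately show ?thesis using arg_cong[OF c_rec[of j], of real] by simp
qed (simp add: c_def)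

text \<open>With \<open>g = f + 1\<close>, \<open>c_rec_real\<close> says that
  \<open>(g - m) * c m - (g - (m + 1)) * c (m + 1)\<close> equals
  \<open>((v - 2) * g - d + 2 * (m + 1)) * c (m + 1)\<close>; this telescopes.\<close>

lemma c_sum_identity:
  "((real v - 2) * (real f + 1) - real d) * (\<Sum>j=1..m. real (c j)) + 2 * (\<Sum>j=1..m. real j * real (c j))
   = (real f + 1) * real (c 0) - (real f + 1 - real m) * real (c m)"
proof (induction m)
  case (Suc m)
  show ?case using Suc c_rec_real[of m] by (simp add: algebra_simps)
qed simp

text \<open>By \<open>c_sum_identity\<close>, this sum is \<open>d * (f + 1)\<close> times the slack in the bound on the number of parts
  of size \<open>f + 1\<close>, up to nonnegative terms of deficit larger than \<open>d\<close>.\<close>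

lemma low_deficit_sum_nonneg:
  assumes v3: "3 \<le> v"
  shows "0 \<le> (\<Sum>j=1..d. ((real d * (real f + 1) * (real v - 1) - real d * real d)
             + (2 * real d - real v * (real f + 1)) * real j) * real (c j))"
proof (cases "d = 2")
  case True
  \<comment> \<open>For \<open>d = 2\<close> the endpoint condition of
    \<open>linear_weighted_sum_nonneg\<close> can fail when \<open>v = 3\<close>, so the two terms
    are compared directly.\<close>
  have "real ((v - 1) * c 2) \<le> real (c 1)" using c_ratio[of 1] by (simp only: of_nat_le_iff) (simp add: numeral_2_eq_2)
  then have c12: "(real v - 1) * real (c 2) \<le> real (c 1)" using v3 by (simp add: of_nat_diff)
  have "(2 * 1) * real (c 2) \<le> ((real v - 1) * (real v - 2)) * real (c 2)"
    using v3 by (intro mult_right_mono mult_mono) auto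
  also have "\<dots> \<le> (real v - 2) * real (c 1)"
    using mult_left_mono[OF c12, of "real v - 2"] v3 by (simp add: algebra_simps)
  finally have "(real f + 1) * (2 * real (c 2)) \<le> (real f + 1) * ((real v - 2) * real (c 1))"
    by (intro mult_left_mono) auto
  moreover have "{1..2} = {1, 2::nat}" by auto
  ultimately show ?thesis using True by (simp add: algebra_simps)
next
  case False
  define q where "q = real v - 1"
  define g where "g = real f + 1"
  have q: "2 \<le> q" and g: "2 \<le> g" and d3: "3 \<le> real d" and dq: "real d \<le> q + 2"
    using v3 f_ge d_ge d_le False by (auto simp: q_def g_def)
  have v: "real v = q + 1" by (simp add: q_def)
  have dq3: "3 * q \<le> real d * q" using d3 q by (intro mult_right_mono) auto
  show ?thesis unfolding g_def[symmetric] v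
  proof (rule linear_weighted_sum_nonneg)
    show "real (c j) \<le> real (c i)" if "1 \<le> i" "i \<le> j" for i j using c_antimono[OF that] by simp
    have "2 * (real d * q - q - 1) \<le> g * (real d * q - q - 1)"
      using g dq3 q by (intro mult_right_mono) linarith+
    then have "2 * (real d * q) - 2 * q - 2 \<le> g * (real d * q - q - 1)"
      by (simp only: right_diff_distrib mult_1_right)
    moreover have "real d * real d \<le> real d * (q + 2)" using dq by (intro mult_left_mono) auto
    moreover have "real d * (q + 2) = real d * q + 2 * real d"
      "real d * g * (q + 1 - 1) - real d * real d + (2 * real d - (q + 1) * g)
        = g * (real d * q - q - 1) - real d * real d + 2 * real d"
      by (simp_all add: algebra_simps)
    moreover have "0 \<le> G - D + 2 * e"
      if "2 * x - 2 * q - 2 \<le> G" "D \<le> x + 2 * e" "3 * q \<le> x" for G D e x :: real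
      using that q by linarith
    ultimately show "0 \<le> real d * g * (q + 1 - 1) - real d * real d + (2 * real d - (q + 1) * g)"
      using dq3 by metis
    \<comment> \<open>The first and the last weight add up to
      \<open>g * (d * (q - 1) - q - 1) + 2 * d\<close>.\<close>
    have "3 * (q - 1) \<le> real d * (q - 1)" using d3 q by (intro mult_right_mono) auto
    then have "0 \<le> g * (real d * (q - 1) - q - 1)" using q g by (intro mult_nonneg_nonneg) auto
    then show "0 \<le> (real d * g * (q + 1 - 1) - real d * real d + (2 * real d - (q + 1) * g)) +
        (real d * g * (q + 1 - 1) - real d * real d + (2 * real d - (q + 1) * g) * real d)"
      by (simp add: algebra_simps)
    show "1 \<le> d" using d_ge by simp
  qed simp
qed

text \<open>For \<open>v \<ge> 3\<close>, multiply by \<open>f + 1\<close> and eliminate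
  \<open>c 0\<close> by \<open>c_sum_identity\<close>, whose boundary term vanishes since
  \<open>c m = 0\<close>. What remains is the sum in \<open>low_deficit_sum_nonneg\<close> plus a
  nonnegative tail. For \<open>v = 2\<close> binomial symmetry gives equality.\<close>

lemma top_size_bound_real:
  assumes m: "m = d + f + 1"
  shows "real v * real total_deficit + real d * (real (c d) + (real v - 2) * (\<Sum>j=d..m. real (c j)))
    \<le> real d * (real (c 0) + (\<Sum>j=1..<d. real (c j)))"
proof (cases "v = 2")
  case True
  then consider "d = 2" | "d = 3" using d_ge d_le by linarith
  then show ?thesis
  proof cases
    case 1
    then have "N = 2 * f" using N_eq True by simp
    then have "c 2 = c 0" unfolding c_def using f_ge binomial_symmetric[of "f + 1" N] by simp
    moreover have "{1..<2} = {1::nat}" by auto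
    ultimately show ?thesis unfolding total_deficit_def using True 1 by simp
  next
    case 2
    then have N: "N + 1 = 2 * f" using N_eq True by simp
    then have "N - (f - 1) = f" by linarith
    then have "c 2 = c 1" unfolding c_def using f_ge f_le_N binomial_symmetric[of "f - 1" N] by simp
    moreover have "c 3 = c 0"
    proof (cases "f = 1")
      case True
      then show ?thesis unfolding c_def using N by simp
    next
      case False
      then have "2 \<le> f" "f + 1 \<le> N" "N - (f + 1) = f - 2" using N f_ge by linarith+
      then show ?thesis unfolding c_def using binomial_symmetric[of "f + 1" N] by simp
    qed
    moreover have "{1..<3} = {1, 2::nat}" by auto
    ultimately show ?thesis unfolding total_deficit_def using True 2 by simp
  qed
next
  case False
  then have v3: "3 \<le> v" using v_ge by simp
  define S1 S2 T1 T2 where "S1 = (\<Sum>j=1..<d. real (c j))" and "S2 = (\<Sum>j=1..<d. real j * real (c j))"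
    and "T1 = (\<Sum>j=Suc d..m. real (c j))" and "T2 = (\<Sum>j=Suc d..m. real j * real (c j))"
  define q where "q = real v - 1"
  define g where "g = real f + 1"
  have split: "(\<Sum>j=1..m. h j) = (\<Sum>j=1..<d. h j) + h d + (\<Sum>j=Suc d..m. h j)" for h :: "nat \<Rightarrow> real"
  proof -
    have "(\<Sum>j=1..m. h j) = (\<Sum>j=1..<d. h j) + (\<Sum>j=d..m. h j)"
      using d_ge m by (simp add: sum.atLeastLessThan_concat flip: atLeastLessThanSuc_atLeastAtMost)
    then show ?thesis using m by (simp add: sum.atLeast_Suc_atMost)
  qed
  have "c m = 0" using m d_ge by (simp add: c_def)
  then have id: "((q - 1) * g - real d) * (S1 + real (c d) + T1) + 2 * (S2 + real d * real (c d) + T2)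
      = g * real (c 0)"
    using c_sum_identity[of m] unfolding split S1_def S2_def T1_def T2_def g_def q_def by simp
  have "real (Suc d) * T1 \<le> T2" unfolding T1_def T2_def sum_distrib_left
    by (intro sum_mono mult_right_mono) auto
  moreover have "0 \<le> T1" unfolding T1_def by (intro sum_nonneg) auto
  moreover have "real (Suc d) * T1 = real d * T1 + T1" by (simp add: algebra_simps)
  ultimately have "real d * T1 \<le> 2 * T2"
    using mult_nonneg_nonneg[of "real d" T1] by linarith
  then have tail: "0 \<le> real d * (2 * T2 - real d * T1)" by simp
  have set_d: "{1..d} = insert d {1..<d}" using d_ge by auto
  have "(\<Sum>j=1..d. ((real d * g * q - real d * real d) + (2 * real d - (q + 1) * g) * real j) * real (c j))
     = (real d * g * q - real d * real d) * (S1 + real (c d)) + (2 * real d - (q + 1) * g) * (S2 + real d * real (c d))"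
    unfolding set_d S1_def S2_def
    by (simp add: sum.distrib sum_distrib_left algebra_simps sum_subtractf)
  then have "0 \<le> (real d * g * q - real d * real d) * (S1 + real (c d)) + (2 * real d - (q + 1) * g) * (S2 + real d * real (c d))"
    using low_deficit_sum_nonneg[OF v3] by (simp add: g_def q_def)
  also have "\<dots> + real d * (2 * T2 - real d * T1) =
      g * (real d * (real (c 0) + S1) - ((q + 1) * S2 + real d * (real (c d) + (q - 1) * (real (c d) + T1))))"
  proof -
    have "real d * (((q - 1) * g - real d) * (S1 + real (c d) + T1) + 2 * (S2 + real d * real (c d) + T2))
      = real d * (g * real (c 0))" using id by simp
    then show ?thesis by (simp add: algebra_simps)
  qed
  finally have "0 \<le> g * (real d * (real (c 0) + S1) - ((q + 1) * S2 + real d * (real (c d) + (q - 1) * (real (c d) + T1))))"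
    using tail by simp
  then have "(q + 1) * S2 + real d * (real (c d) + (q - 1) * (real (c d) + T1)) \<le> real d * (real (c 0) + S1)"
    by (simp add: zero_le_mult_iff g_def)
  moreover have "(\<Sum>j=d..m. real (c j)) = real (c d) + T1"
    using m unfolding T1_def by (simp add: sum.atLeast_Suc_atMost)
  moreover have "real total_deficit = S2" by (simp add: total_deficit_def S2_def)
  ultimately show ?thesis by (simp add: S1_def q_def)
qed

text \<open>Counts parts of size \<open>f + 1\<close>, of which \<open>c 0\<close> are available:
  the packed columns use \<open>K * v\<close> minus the number of items, the other columns
  \<open>v - 2\<close> each, and one more if the small part has deficit exactly
  \<open>d\<close>.\<close>

lemma top_size_bound:
  "K * v + c d + (v - 2) * (\<Sum>j=d..d+f+1. c j) \<le> c 0 + (\<Sum>j=1..<d. c_used j)"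
proof -
  define w where "w = total_deficit - K * d"
  have w: "total_deficit = K * d + w" "w < d"
    using K_mult_le total_deficit_less by (auto simp: w_def algebra_simps)
  define A where "A = (\<Sum>j=d..d+f+1. c j)"
  define C1 where "C1 = (\<Sum>j=1..<d. c j)"
  have "c1_used + w = c 1"
    using total_deficit_split deficit_ge2_le w by (simp add: c1_used_def)
  moreover have "(\<Sum>j=1..<d. c_used j) = c1_used + (\<Sum>j=2..<d. c_used j)"
    using d_ge by (simp add: sum.atLeast_Suc_lessThan numeral_2_eq_2 c_used_def)
  moreover have "(\<Sum>j=2..<d. c_used j) = (\<Sum>j=2..<d. c j)"
    by (intro sum.cong) (auto simp: c_used_def)
  moreover have "C1 = c 1 + (\<Sum>j=2..<d. c j)"
    using d_ge unfolding C1_def by (simp add: sum.atLeast_Suc_lessThan numeral_2_eq_2)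
  ultimately have used: "(\<Sum>j=1..<d. c_used j) + w = C1" by simp
  have "real v * real total_deficit + real d * (real (c d) + (real v - 2) * real A) \<le> real d * (real (c 0) + real C1)"
    using top_size_bound_real[OF refl] by (simp add: A_def C1_def)
  then have "real (v * total_deficit + d * (c d + (v - 2) * A)) \<le> real (d * (c 0 + C1))"
    using v_ge by (simp add: of_nat_diff)
  then have "v * total_deficit + d * (c d + (v - 2) * A) \<le> d * (c 0 + C1)" by (simp only: of_nat_le_iff)
  then have "d * (K * v + c d + (v - 2) * A) + v * w \<le> d * (c 0 + C1)"
    unfolding w(1) by (simp add: algebra_simps)
  \<comment> \<open>The discarded remainder \<open>w\<close> is paid for by
    \<open>d \<le> v + 1\<close>, up to an error below \<open>d\<close>, which is lost on division
    by \<open>d\<close>.\<close>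
  moreover have "d * w \<le> v * w + w" using mult_le_mono1[OF d_le, of w] by simp
  ultimately have "d * (K * v + c d + (v - 2) * A + w) < d * (c 0 + C1 + 1)"
    using w(2) by (simp add: algebra_simps)
  then have "K * v + c d + (v - 2) * A + w < c 0 + C1 + 1" by (simp only: mult_less_cancel1)
  then show ?thesis using used by (simp add: A_def)
qed

end

section \<open>Counting subsets by size, and arrays from column shapes\<close>

lemma sum_over_subsets_by_card:
  assumes "finite X"
  shows "(\<Sum>S\<in>Pow X. w (card S)) = (\<Sum>i\<le>card X. (card X choose i) * w i :: nat)"
proof -
  have "(\<Sum>S\<in>Pow X. w (card S)) = (\<Sum>i\<le>card X. \<Sum>S\<in>{S \<in> Pow X. card S = i}. w (card S))"
    using assms by (intro sum.group[symmetric]) (auto intro: card_mono)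
  also have "\<dots> = (\<Sum>i\<le>card X. (card X choose i) * w i)"
  proof (rule sum.cong[OF refl])
    fix i
    have "(\<Sum>S\<in>{S \<in> Pow X. card S = i}. w (card S)) = card {S \<in> Pow X. card S = i} * w i"
      by simp
    then show "(\<Sum>S\<in>{S \<in> Pow X. card S = i}. w (card S)) = (card X choose i) * w i"
      using n_subsets[OF assms, of i] by (simp add: Pow_def)
  qed
  finally show ?thesis .
qed

text \<open>Unimodality, after reflecting \<open>b\<close> if it lies beyond the middle.\<close>

lemma binomial_le_binomial:
  assumes "a \<le> b" "a + b \<le> N"
  shows "N choose a \<le> N choose b"
proof (cases "2 * b \<le> N")
  case True
  then show ?thesis using assms by (intro binomial_mono) auto
next
  case False
  have "N choose a \<le> N choose (N - b)" using assms False by (intro binomial_mono) auto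
  then show ?thesis using binomial_symmetric[of b N] assms by simp
qed

lemma count_image_mset_set:
  assumes "finite B"
  shows "count (image_mset g (mset_set B)) i = card {x \<in> B. g x = i}"
proof -
  have "g -` {i} \<inter> B = {x \<in> B. g x = i}" by auto
  then show ?thesis using assms by (simp add: count_image_mset)
qed

text \<open>Multisets suffice because symbols may be permuted within a column; sorting fixes which
  symbol gets which size.\<close>

lemma locating_array_of_shapes:
  fixes M :: "'a \<Rightarrow> nat multiset"
  assumes fin: "finite \<Gamma>"
    and shape: "\<And>\<gamma>. \<gamma> \<in> \<Gamma> \<Longrightarrow> size (M \<gamma>) = v \<and> sum_mset (M \<gamma>) = N"
    and few: "\<And>i. (\<Sum>\<gamma>\<in>\<Gamma>. count (M \<gamma>) i) \<le> N choose i"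
  shows "\<exists>A. locating_array_11 N (card \<Gamma>) v {..<v} A"
proof -
  obtain e where e: "bij_betw e {1..card \<Gamma>} \<Gamma>" using ex_bij_betw_nat_finite_1[OF fin] by blast
  define xs where "xs \<gamma> = sorted_list_of_multiset (M (e \<gamma>))" for \<gamma>
  have mset: "mset (xs \<gamma>) = M (e \<gamma>)" for \<gamma> by (simp add: xs_def)
  have e_in: "e \<gamma> \<in> \<Gamma>" if "\<gamma> \<in> {1..card \<Gamma>}" for \<gamma> using e that by (auto simp: bij_betw_def)
  have len: "length (xs \<gamma>) = v" if "\<gamma> \<in> {1..card \<Gamma>}" for \<gamma>
    using shape[OF e_in[OF that]] mset[of \<gamma>] by (metis size_mset)
  have "\<exists>A. (\<forall>r\<in>{1..N}. \<forall>\<gamma>\<in>{1..card \<Gamma>}. A r \<gamma> < v) \<and> inj_on (rho N A) ({1..card \<Gamma>} \<times> {..<v})"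
  proof (rule array_with_prescribed_sizes[where t = "\<lambda>\<gamma> \<sigma>. xs \<gamma> ! \<sigma>"])
    fix \<gamma> assume g: "\<gamma> \<in> {1..card \<Gamma>}"
    have "(\<Sum>\<sigma><v. xs \<gamma> ! \<sigma>) = sum_list (xs \<gamma>)"
      using len[OF g] by (simp add: sum_list_sum_nth atLeast0LessThan)
    also have "\<dots> = N" using shape[OF e_in[OF g]] mset[of \<gamma>] by (metis sum_mset_sum_list)
    finally show "(\<Sum>\<sigma><v. xs \<gamma> ! \<sigma>) = N" .
  next
    fix i
    have "{(\<gamma>, \<sigma>) \<in> {1..card \<Gamma>} \<times> {..<v}. xs \<gamma> ! \<sigma> = i}
        = Sigma {1..card \<Gamma>} (\<lambda>\<gamma>. {\<sigma>. \<sigma> < v \<and> xs \<gamma> ! \<sigma> = i})" by auto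
    then have "card {(\<gamma>, \<sigma>) \<in> {1..card \<Gamma>} \<times> {..<v}. xs \<gamma> ! \<sigma> = i}
        = (\<Sum>\<gamma>=1..card \<Gamma>. card {\<sigma>. \<sigma> < v \<and> xs \<gamma> ! \<sigma> = i})" by (simp add: card_SigmaI)
    also have "\<dots> = (\<Sum>\<gamma>=1..card \<Gamma>. count (M (e \<gamma>)) i)"
    proof (rule sum.cong[OF refl])
      fix \<gamma> assume g: "\<gamma> \<in> {1..card \<Gamma>}"
      have "count (mset (xs \<gamma>)) i = length (filter ((=) i) (xs \<gamma>))"
        by (simp add: count_mset count_list_eq_length_filter)
      also have "\<dots> = card {\<sigma>. \<sigma> < v \<and> xs \<gamma> ! \<sigma> = i}"
        unfolding length_filter_conv_card len[OF g] by (rule arg_cong[of _ _ card]) auto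
      finally show "card {\<sigma>. \<sigma> < v \<and> xs \<gamma> ! \<sigma> = i} = count (M (e \<gamma>)) i" by (simp add: mset)
    qed
    also have "\<dots> = (\<Sum>\<gamma>\<in>\<Gamma>. count (M \<gamma>) i)" using e by (rule sum.reindex_bij_betw)
    finally show "card {(\<gamma>, \<sigma>) \<in> {1..card \<Gamma>} \<times> {..<v}. xs \<gamma> ! \<sigma> = i} \<le> N choose i"
      using few[of i] by simp
  qed simp
  then obtain A where "\<forall>r\<in>{1..N}. \<forall>\<gamma>\<in>{1..card \<Gamma>}. A r \<gamma> < v"
    "inj_on (rho N A) ({1..card \<Gamma>} \<times> {..<v})" by blast
  then have "locating_array_11 N (card \<Gamma>) v {..<v} A"
    unfolding locating_array_11_def by (auto dest: inj_onD)
  then show ?thesis by blast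
qed

section \<open>The upper bound\<close>

context la_parameters
begin

text \<open>The upper limit goes past \<open>f + 1\<close>, where \<open>c\<close> vanishes, so that
  the range contains \<open>j = d\<close> even if \<open>d > f + 1\<close>.\<close>

definition small_sets :: nat where
  "small_sets = (\<Sum>j=d..d+f+1. c j)"

lemma small_sets_eq: "small_sets = (\<Sum>i<f+2-d. N choose i)"
proof -
  have "small_sets = (\<Sum>j\<in>{d..f+1}. c j)"
    unfolding small_sets_def by (intro sum.mono_neutral_right) (auto simp: c_def)
  also have "\<dots> = (\<Sum>i<f+2-d. N choose i)"
    by (rule sum.reindex_bij_witness[where i = "\<lambda>i. f + 1 - i" and j = "\<lambda>j. f + 1 - j"])
      (auto simp: c_def)
  finally show ?thesis .
qed

lemma truncated_deficit_sum:
  "(\<Sum>i\<le>N. (N choose i) * min d (f + 1 - i)) = total_deficit + d * small_sets"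
proof -
  have "(\<Sum>i\<le>N. (N choose i) * min d (f + 1 - i)) = (\<Sum>i\<le>N + f + 1. (N choose i) * min d (f + 1 - i))"
    by (intro sum.mono_neutral_left) auto
  also have "\<dots> = (\<Sum>i\<le>f + 1. (N choose i) * min d (f + 1 - i))"
    by (intro sum.mono_neutral_right) auto
  also have "\<dots> = (\<Sum>j\<le>f + 1. c j * min d j)"
    by (rule sum.reindex_bij_witness[where i = "\<lambda>i. f + 1 - i" and j = "\<lambda>j. f + 1 - j"])
      (auto simp: c_def)
  also have "\<dots> = (\<Sum>j\<in>{1..<d} \<union> {d..d+f+1}. c j * min d j)"
    by (rule sum.mono_neutral_cong) (auto simp: c_def)
  also have "\<dots> = (\<Sum>j=1..<d. c j * min d j) + (\<Sum>j=d..d+f+1. c j * min d j)"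
    by (rule sum.union_disjoint) auto
  also have "(\<Sum>j=1..<d. c j * min d j) = total_deficit"
    unfolding total_deficit_def by (intro sum.cong) auto
  also have "(\<Sum>j=d..d+f+1. c j * min d j) = d * small_sets"
    unfolding small_sets_def sum_distrib_left by (intro sum.cong) auto
  finally show ?thesis .
qed

lemma locating_array_columns_le:
  assumes "locating_array_11 N k v \<Sigma> A"
  shows "k \<le> K + small_sets"
proof -
  have fin: "finite \<Sigma>" and card: "card \<Sigma> = v"
    and ent: "\<And>r \<gamma>. r \<in> {1..N} \<Longrightarrow> \<gamma> \<in> {1..k} \<Longrightarrow> A r \<gamma> \<in> \<Sigma>"
    using assms by (auto simp: locating_array_11_def)
  have inj: "inj_on (rho N A) ({1..k} \<times> \<Sigma>)"
    using assms unfolding locating_array_11_def by (auto intro!: inj_onI)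
  define w where "w i = min d (f + 1 - i)" for i
  have col: "d \<le> (\<Sum>\<sigma>\<in>\<Sigma>. w (card (rho N A (\<gamma>, \<sigma>))))" if g: "\<gamma> \<in> {1..k}" for \<gamma>
  \<comment> \<open>In the first case one part alone reaches \<open>d\<close>. In the second no
    deficit is cut off at \<open>d\<close>, and raising negative deficits to 0 only increases the
    sum.\<close>
  proof (cases "\<exists>\<sigma>\<in>\<Sigma>. d \<le> f + 1 - card (rho N A (\<gamma>, \<sigma>))")
    case True
    then obtain \<sigma> where s: "\<sigma> \<in> \<Sigma>" "d \<le> f + 1 - card (rho N A (\<gamma>, \<sigma>))" by blast
    then have "d = w (card (rho N A (\<gamma>, \<sigma>)))" by (simp add: w_def)
    also have "\<dots> \<le> (\<Sum>\<sigma>\<in>\<Sigma>. w (card (rho N A (\<gamma>, \<sigma>))))"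
      by (rule member_le_sum) (use s fin in auto)
    finally show ?thesis .
  next
    case False
    have "{r\<in>{1..N}. A r \<gamma> \<in> \<Sigma>} = {1..N}" using ent g by auto
    then have N: "(\<Sum>\<sigma>\<in>\<Sigma>. card (rho N A (\<gamma>, \<sigma>))) = N"
      using card_preimage_eq_sum[of "{1..N}" \<Sigma> "\<lambda>r. A r \<gamma>"] fin by (simp add: rho_def)
    have "N + d = (\<Sum>\<sigma>\<in>\<Sigma>. f + 1)" using N_eq card by (simp add: mult.commute)
    also have "\<dots> \<le> (\<Sum>\<sigma>\<in>\<Sigma>. w (card (rho N A (\<gamma>, \<sigma>))) + card (rho N A (\<gamma>, \<sigma>)))"
      using False by (intro sum_mono) (auto simp: w_def)
    also have "\<dots> = (\<Sum>\<sigma>\<in>\<Sigma>. w (card (rho N A (\<gamma>, \<sigma>)))) + N" by (simp add: sum.distrib N)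
    finally show ?thesis by simp
  qed
  have "k * d = (\<Sum>\<gamma>=1..k. d)" by simp
  also have "\<dots> \<le> (\<Sum>\<gamma>=1..k. \<Sum>\<sigma>\<in>\<Sigma>. w (card (rho N A (\<gamma>, \<sigma>))))"
    using col by (intro sum_mono) auto
  also have "\<dots> = (\<Sum>p\<in>{1..k} \<times> \<Sigma>. w (card (rho N A p)))"
    by (simp add: sum.cartesian_product)
  also have "\<dots> = (\<Sum>S\<in>rho N A ` ({1..k} \<times> \<Sigma>). w (card S))"
    using inj by (simp add: sum.reindex)
  also have "\<dots> \<le> (\<Sum>S\<in>Pow {1..N}. w (card S))"
    by (intro sum_mono2) (auto simp: rho_def)
  also have "\<dots> = (\<Sum>i\<le>N. (N choose i) * min d (f + 1 - i))"
    using sum_over_subsets_by_card[of "{1..N}" w] by (simp add: w_def)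
  also have "\<dots> < (K + 1 + small_sets) * d"
    using truncated_deficit_sum total_deficit_less by (simp add: algebra_simps)
  finally have "k < K + 1 + small_sets" by (simp only: mult_less_cancel2)
  then show ?thesis by simp
qed

end

subsection \<open>The extremal number of columns\<close>

context la_parameters
begin

text \<open>Stand-ins for the sets of deficit below \<open>d\<close>: only the deficits matter for
  the packing, and the second component tells equal ones apart.\<close>

definition items :: "(nat \<times> nat) set" where
  "items = Sigma {1..<d} (\<lambda>j. {..<c_used j})"

lemma finite_items: "finite items"
  by (simp add: items_def)

lemma fst_items:
  assumes "x \<in> items"
  shows "1 \<le> fst x" "fst x < d" "fst x \<le> f + 1"
proof -
  have "0 < c (fst x)" using assms c_used_le[of "fst x"] by (auto simp: items_def)
  then show "fst x \<le> f + 1" by (simp add: c_def split: if_splits)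
  show "1 \<le> fst x" "fst x < d" using assms by (auto simp: items_def)
qed

lemma sum_items: "(\<Sum>x\<in>Sigma J (\<lambda>j. {..<c_used j}). fst x) = (\<Sum>j\<in>J. j * c_used j)" if "finite J"
proof -
  have "(\<Sum>j\<in>J. \<Sum>r<c_used j. j) = (\<Sum>(j, r)\<in>Sigma J (\<lambda>j. {..<c_used j}). j)"
    using that by (intro sum.Sigma) auto
  then show ?thesis by (simp add: case_prod_unfold mult.commute)
qed

lemma items_packing:
  "\<exists>b. b ` items \<subseteq> {..<K} \<and>
    (\<forall>k<K. (\<Sum>x\<in>{x\<in>items. b x = k}. fst x) = d \<and> card {x\<in>items. b x = k} \<le> v)"
proof (rule exact_packing)
  show "finite items" by (rule finite_items)
  show "1 \<le> fst x \<and> fst x \<le> d" if "x \<in> items" for x using fst_items[OF that] by simp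
  show "(\<Sum>y\<in>{y\<in>items. fst x \<le> fst y}. fst y) < K * (d - fst x + 1) + fst x" if "x \<in> items" for x
  proof -
    have "{y\<in>items. fst x \<le> fst y} = Sigma {fst x..<d} (\<lambda>j. {..<c_used j})"
      using fst_items[OF that] by (auto simp: items_def)
    then show ?thesis using c_used_fits[of "fst x"] fst_items[OF that] by (simp add: sum_items)
  qed
  show "sum fst items = K * d" unfolding items_def using c_used_total by (simp add: sum_items)
  have "{x\<in>items. 2 \<le> fst x} = Sigma {2..<d} (\<lambda>j. {..<c_used j})" by (auto simp: items_def)
  then have "card {x\<in>items. 2 \<le> fst x} = (\<Sum>j=2..<d. c_used j)" by (simp add: card_SigmaI)
  also have "\<dots> = (\<Sum>j=2..<d. c j)" by (intro sum.cong) (auto simp: c_used_def)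
  finally show "d \<le> v \<or> (d = v + 1 \<and> K \<le> card {x\<in>items. 2 \<le> fst x})"
    using K_le_deficit_ge2_count d_le by (cases "d = v + 1") auto
qed

lemma locating_array_exists: "\<exists>A. locating_array_11 N (K + small_sets) v {..<v} A"
proof -
  obtain b where b: "b ` items \<subseteq> {..<K}"
    "\<And>k. k < K \<Longrightarrow> (\<Sum>x\<in>{x\<in>items. b x = k}. fst x) = d"
    "\<And>k. k < K \<Longrightarrow> card {x\<in>items. b x = k} \<le> v"
    using items_packing by blast
  define bin where "bin k = {x\<in>items. b x = k}" for k
  have finbin: "finite (bin k)" for k using finite_items by (simp add: bin_def)
  define part where "part x = f + 1 - fst x" for x :: "nat \<times> nat"
  define M1 where "M1 k = image_mset part (mset_set (bin k)) + replicate_mset (v - card (bin k)) (f + 1)" for k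
  \<comment> \<open>The first two parts have total deficit \<open>d\<close>. For
    \<open>p \<in> P\<close> the first alone has deficit at least \<open>d\<close>, so the second
    has size at least \<open>f + 1\<close>.\<close>
  define M2 where "M2 p = {#fst p, 2 * f + 2 - d - fst p#} + replicate_mset (v - 2) (f + 1)"
    for p :: "nat \<times> nat"
  define P where "P = Sigma {..<f+2-d} (\<lambda>i. {..<N choose i})"
  have finP: "finite P" by (simp add: P_def)
  have cardP: "card P = small_sets" by (simp add: P_def card_SigmaI small_sets_eq)
  have sum_P: "(\<Sum>p\<in>P. h (fst p)) = (\<Sum>i<f+2-d. (N choose i) * h i)" for h :: "nat \<Rightarrow> nat"
  proof -
    have "(\<Sum>i<f+2-d. \<Sum>r<N choose i. h i) = (\<Sum>(i, r)\<in>P. h i)"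
      unfolding P_def by (intro sum.Sigma) auto
    then show ?thesis by (simp add: case_prod_unfold)
  qed
  have two: "2 * f + 2 - d \<le> N"
  proof -
    have "(f + 1) * 2 \<le> (f + 1) * v" using v_ge by (intro mult_le_mono2)
    then show ?thesis using N_eq by simp
  qed
  have shape1: "size (M1 k) = v \<and> sum_mset (M1 k) = N" if k: "k < K" for k
  proof
    have le: "card (bin k) \<le> v" using b(3)[OF k] by (simp add: bin_def)
    then show "size (M1 k) = v" by (simp add: M1_def)
    have "(\<Sum>x\<in>bin k. part x) + (\<Sum>x\<in>bin k. fst x) = (\<Sum>x\<in>bin k. f + 1)"
      unfolding sum.distrib[symmetric] part_def using fst_items(3)
      by (intro sum.cong) (auto simp: bin_def)
    then have "(\<Sum>x\<in>bin k. part x) + d = card (bin k) * (f + 1)"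
      using b(2)[OF k] by (simp add: bin_def)
    moreover have "sum_mset (M1 k) = (\<Sum>x\<in>bin k. part x) + (v - card (bin k)) * (f + 1)"
      by (simp add: M1_def sum_unfold_sum_mset)
    moreover have "card (bin k) * (f + 1) + (v - card (bin k)) * (f + 1) = v * (f + 1)"
      using le by (simp flip: add_mult_distrib)
    ultimately show "sum_mset (M1 k) = N" using N_eq by (simp add: mult.commute)
  qed
  have shape2: "size (M2 p) = v \<and> sum_mset (M2 p) = N" if p: "p \<in> P" for p
  proof
    show "size (M2 p) = v" using v_ge by (simp add: M2_def)
    have "fst p + d \<le> f + 1" using p by (auto simp: P_def)
    then have "fst p + (2 * f + 2 - d - fst p) + d = (f + 1) * 2" by simp
    moreover have "(f + 1) * 2 + (v - 2) * (f + 1) = (f + 1) * v"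
      using v_ge by (metis add_mult_distrib2 le_add_diff_inverse mult.commute)
    moreover have "sum_mset (M2 p) = fst p + (2 * f + 2 - d - fst p) + (v - 2) * (f + 1)"
      by (simp add: M2_def)
    ultimately show "sum_mset (M2 p) = N" using N_eq by linarith
  qed
  have count1: "(\<Sum>k<K. count (M1 k) i) =
      card {x\<in>items. part x = i} + (if i = f + 1 then K * v - card items else 0)" for i
  proof -
    have "(\<Sum>k<K. card {x\<in>bin k. part x = i}) = card {x\<in>items. part x = i}"
    proof -
      have "{x\<in>{x\<in>items. part x = i}. b x \<in> {..<K}} = {x\<in>items. part x = i}" using b(1) by auto
      moreover have "{x\<in>{x\<in>items. part x = i}. b x = k} = {x\<in>bin k. part x = i}" for k
        by (auto simp: bin_def)
      ultimately show ?thesis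
        using card_preimage_eq_sum[of "{x\<in>items. part x = i}" "{..<K}" b] finite_items by simp
    qed
    moreover have "(\<Sum>k<K. v - card (bin k)) = K * v - card items"
    proof -
      have "{x\<in>items. b x \<in> {..<K}} = items" using b(1) by auto
      then have "(\<Sum>k<K. card (bin k)) = card items"
        using card_preimage_eq_sum[of items "{..<K}" b] finite_items by (simp add: bin_def)
      moreover have "(\<Sum>k<K. v - card (bin k)) = (\<Sum>k<K. v) - (\<Sum>k<K. card (bin k))"
        using b(3) by (intro sum_subtractf_nat) (auto simp: bin_def)
      ultimately show ?thesis by simp
    qed
    ultimately show ?thesis
      by (simp add: M1_def count_image_mset_set[OF finbin] sum.distrib)
  qed
  have count2: "(\<Sum>p\<in>P. count (M2 p) i) = (if i < f + 2 - d then N choose i else 0)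
      + (\<Sum>i'<f+2-d. (N choose i') * (if 2 * f + 2 - d - i' = i then 1 else 0))
      + (if i = f + 1 then (v - 2) * small_sets else 0)" for i
  proof -
    have "(\<Sum>p\<in>P. count (M2 p) i) = (\<Sum>i'<f+2-d. (N choose i') *
       ((if i' = i then 1 else 0) + (if 2 * f + 2 - d - i' = i then 1 else 0) + (if i = f + 1 then v - 2 else 0)))"
      unfolding sum_P[symmetric] by (intro sum.cong) (auto simp: M2_def)
    also have "\<dots> = (\<Sum>i'<f+2-d. (N choose i') * (if i' = i then 1 else 0))
      + (\<Sum>i'<f+2-d. (N choose i') * (if 2 * f + 2 - d - i' = i then 1 else 0))
      + (\<Sum>i'<f+2-d. (N choose i') * (if i = f + 1 then v - 2 else 0))"
      by (simp only: distrib_left sum.distrib)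
    also have "(\<Sum>i'<f+2-d. (N choose i') * (if i' = i then 1 else 0)) = (if i < f + 2 - d then N choose i else 0)"
      by (simp add: if_distrib cong: if_cong)
    also have "(\<Sum>i'<f+2-d. (N choose i') * (if i = f + 1 then v - 2 else 0)) = (if i = f + 1 then (v - 2) * small_sets else 0)"
      by (simp add: small_sets_eq sum_distrib_left mult.commute)
    finally show ?thesis .
  qed
  have bound: "(\<Sum>k<K. count (M1 k) i) + (\<Sum>p\<in>P. count (M2 p) i) \<le> N choose i" for i
  proof -
    consider "i \<le> f" | "i = f + 1" | "f + 1 < i" by linarith
    then show ?thesis
    proof cases
      case 1
      \<comment> \<open>Sizes up to \<open>f\<close> come from items if the deficit is below
        \<open>d\<close> and from first parts of \<open>M2\<close> otherwise, never from
        both.\<close>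
      have "(\<Sum>i'<f+2-d. (N choose i') * (if 2 * f + 2 - d - i' = i then 1 else 0)) = 0"
        using 1 by (intro sum.neutral) auto
      then have two: "(\<Sum>p\<in>P. count (M2 p) i) = (if i < f + 2 - d then N choose i else 0)"
        using count2[of i] 1 by simp
      have one: "(\<Sum>k<K. count (M1 k) i) = card {x\<in>items. part x = i}" using count1[of i] 1 by simp
      have sub: "{x\<in>items. part x = i} \<subseteq> (if f + 1 - i < d then {f + 1 - i} \<times> {..<c_used (f + 1 - i)} else {})"
        using fst_items by (fastforce simp: items_def part_def)
      show ?thesis
      proof (cases "f + 1 - i < d")
        case True
        have "card {x\<in>items. part x = i} \<le> card ({f + 1 - i} \<times> {..<c_used (f + 1 - i)})"
          using sub True by (intro card_mono) auto
        also have "\<dots> \<le> c (f + 1 - i)" using c_used_le[of "f + 1 - i"] by simp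
        also have "\<dots> = N choose i" using 1 by (simp add: c_def)
        finally show ?thesis using one two True by auto
      next
        case False
        then have "{x\<in>items. part x = i} = {}" using sub by (simp only: if_False subset_empty)
        then have "card {x\<in>items. part x = i} = 0" by (simp only: card.empty)
        then show ?thesis using one two by simp
      qed
    next
      case 2
      have none: "{x\<in>items. part x = i} = {}" using 2 fst_items(1,3) by (fastforce simp: part_def)
      have one: "(\<Sum>k<K. count (M1 k) i) = K * v - card items"
        unfolding count1[of i] none using 2 by simp
      \<comment> \<open>The completing part has size \<open>f + 1\<close> exactly when
        \<open>i' = f + 1 - d\<close>; for \<open>d > f + 1\<close> both sides are 0.\<close>
      have "(\<Sum>i'<f+2-d. (N choose i') * (if 2 * f + 2 - d - i' = i then 1 else 0)) = c d"
      proof (cases "d \<le> f + 1")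
        case True
        have "(\<Sum>i'<f+2-d. (N choose i') * (if 2 * f + 2 - d - i' = i then 1 else 0))
            = (\<Sum>i'<f+2-d. if i' = f + 1 - d then N choose i' else 0)"
          using 2 True by (intro sum.cong) auto
        also have "\<dots> = c d" using True by (simp add: c_def)
        finally show ?thesis .
      qed (simp add: c_def)
      moreover have "\<not> i < f + 2 - d" using 2 d_ge by simp
      ultimately have two: "(\<Sum>p\<in>P. count (M2 p) i) = c d + (v - 2) * small_sets"
        using count2[of i] 2 by simp
      have "card items = (\<Sum>j=1..<d. c_used j)" by (simp add: items_def card_SigmaI)
      then have "K * v + c d + (v - 2) * small_sets \<le> c 0 + card items"
        using top_size_bound by (simp add: small_sets_def)
      moreover have "card items \<le> K * v"
      proof -
        have "{x\<in>items. b x \<in> {..<K}} = items" using b(1) by auto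
        then have "card items = (\<Sum>k<K. card (bin k))"
          using card_preimage_eq_sum[of items "{..<K}" b] finite_items by (simp add: bin_def)
        also have "\<dots> \<le> (\<Sum>k<K. v)" using b(3) by (intro sum_mono) (auto simp: bin_def)
        finally show ?thesis by simp
      qed
      ultimately show ?thesis using one two 2 by (simp add: c_def)
    next
      case 3
      have none: "{x\<in>items. part x = i} = {}" using 3 by (auto simp: part_def)
      have one: "(\<Sum>k<K. count (M1 k) i) = 0" unfolding count1[of i] none using 3 by simp
      have "(\<Sum>p\<in>P. count (M2 p) i) = (\<Sum>i'<f+2-d. (N choose i') * (if 2 * f + 2 - d - i' = i then 1 else 0))"
      proof -
        have "\<not> i < f + 2 - d" using 3 by simp
        then show ?thesis using count2[of i] 3 by simp
      qed
      also have "\<dots> \<le> N choose i"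
      proof (cases "i \<le> 2 * f + 2 - d")
        case True
        \<comment> \<open>A completing part of size \<open>i\<close> belongs to a set of size
          \<open>a < i\<close> with \<open>a + i \<le> N\<close> by \<open>two\<close>, so there are
          at least as many sets of size \<open>i\<close>.\<close>
        define a where "a = 2 * f + 2 - d - i"
        have "(\<Sum>i'<f+2-d. (N choose i') * (if 2 * f + 2 - d - i' = i then 1 else 0))
          \<le> (\<Sum>i'<f+2-d. if i' = a then N choose i' else 0)"
          using True 3 by (intro sum_mono) (auto simp: a_def)
        also have "\<dots> \<le> N choose a" by simp
        also have "\<dots> \<le> N choose i" using two True 3 by (intro binomial_le_binomial) (auto simp: a_def)
        finally show ?thesis .
      next
        case False
        then have "(\<Sum>i'<f+2-d. (N choose i') * (if 2 * f + 2 - d - i' = i then 1 else 0)) = 0"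
          by (intro sum.neutral) auto
        then show ?thesis by linarith
      qed
      finally show ?thesis using one by simp
    qed
  qed
  have "\<exists>A. locating_array_11 N (card ({..<K} <+> P)) v {..<v} A"
  proof (rule locating_array_of_shapes[where M = "case_sum M1 M2"])
    show "finite ({..<K} <+> P)" using finP by simp
    show "size (case_sum M1 M2 \<gamma>) = v \<and> sum_mset (case_sum M1 M2 \<gamma>) = N" if "\<gamma> \<in> {..<K} <+> P" for \<gamma>
      using that shape1 shape2 by auto
    show "(\<Sum>\<gamma>\<in>{..<K} <+> P. count (case_sum M1 M2 \<gamma>) i) \<le> N choose i" for i
      using bound[of i] finP by (simp add: sum.Plus)
  qed
  then show ?thesis using finP by (simp add: card_Plus cardP)
qed

lemma LAK_11_eq: "LAK_11 N v = K + small_sets"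
  unfolding LAK_11_def
proof (rule Greatest_equality)
  show "\<exists>(\<Sigma> :: nat set) A. locating_array_11 N (K + small_sets) v \<Sigma> A"
    using locating_array_exists by blast
  show "k \<le> K + small_sets" if "\<exists>(\<Sigma> :: nat set) A. locating_array_11 N k v \<Sigma> A" for k
    using that locating_array_columns_le by blast
qed

lemma Lambda_eq: "Lambda N v = int (K + small_sets)"
proof -
  have "(N + 1) div v = f"
  proof (rule div_nat_eqI)
    show "v * f \<le> N + 1" using fv_le by (simp add: mult.commute)
    show "N + 1 < v * Suc f" using N_eq d_ge by (simp add: mult.commute)
  qed
  then have f: "\<lfloor>real (N + 1) / real v\<rfloor> = int f" by (metis floor_divide_of_nat_eq)
  have d: "(int f + 1) * int v - int N = int d"
    using arg_cong[OF N_eq, of int] by (simp add: algebra_simps)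
  \<comment> \<open>Negative \<open>i\<close> correspond to \<open>j > f + 1\<close>, where
    \<open>binom\<close> and \<open>c\<close> are both 0.\<close>
  have "(\<Sum>i = int f - int d + 2..int f. (int f + 1 - i) * binom N i) = (\<Sum>j=1..<d. int (j * c j))"
    by (rule sum.reindex_bij_witness[where i = "\<lambda>j. int f + 1 - int j" and j = "\<lambda>i. nat (int f + 1 - i)"])
      (auto simp: c_def binom_def nat_diff_distrib nat_add_distrib)
  then have deficit: "(\<Sum>i = int f - int d + 2..int f. (int f + 1 - i) * binom N i) = int total_deficit"
    by (simp add: total_deficit_def)
  \<comment> \<open>For \<open>f + 1 < d\<close> both index ranges are empty.\<close>
  have "(\<Sum>i = 0..int f - int d + 1. binom N i) = (\<Sum>i<f+2-d. int (N choose i))"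
    by (rule sum.reindex_bij_witness[where i = int and j = nat]) (auto simp: binom_def)
  then have small: "(\<Sum>i = 0..int f - int d + 1. binom N i) = int small_sets"
    by (simp add: small_sets_eq)
  have "\<lfloor>1 / real_of_int (int d) * real_of_int (int total_deficit)\<rfloor> = int K"
    by (simp add: K_def floor_divide_of_nat_eq)
  then show ?thesis unfolding Lambda_def Let_def f d deficit small by simp
qed

end

theorem theorem1p2:
  fixes N v :: nat
  assumes "2 \<le> v" and "v \<le> N + 1"
  shows "int (LAK_11 N v) = Lambda N v"
proof -
  define f where "f = (N + 1) div v"
  define d where "d = (f + 1) * v - N"
  have mod: "f * v + (N + 1) mod v = N + 1" "(N + 1) mod v < v"
    using assms by (auto simp: f_def)
  have "1 \<le> f" using assms by (simp add: f_def Suc_le_eq div_greater_zero_iff)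
  moreover have "N + d = (f + 1) * v" "2 \<le> d" "d \<le> v + 1"
    using mod by (auto simp: d_def algebra_simps)
  ultimately interpret la_parameters N v f d using assms(1) by unfold_locales
  show ?thesis using LAK_11_eq Lambda_eq by simp
qed

end
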